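(* Let $p$ be an odd prime and let $R$ be a unital ring of order $p^2$. Then the Schur multiplier of the Heisenberg group $\mathbb{H}_3(R)$ is given, up to isomorphism, by $$\mathrm{H}^2\big(\mathbb{H}_{3}(R),\mathbb{C}^\times\big)\cong\begin{cases}(\mathbb{Z}/p\mathbb{Z})^{8} & \text{if } R \cong \mathbb{F}_p[t]/(t^2),\\ (\mathbb{Z}/p\mathbb{Z})^{8} & \text{if } R \cong \mathbb{F}_{p^2},\\ (\mathbb{Z}/p\mathbb{Z})^{8} & \text{if } R \cong \mathbb{Z}/p\mathbb{Z}\times\mathbb{Z}/p\mathbb{Z},\\ (\mathbb{Z}/p^2\mathbb{Z})^{2} & \text{if } R \cong \mathbb{Z}/p^2\mathbb{Z}.\end{cases}$$
   Context: Every unital ring of order $p^2$ is commutative and isomorphic to one of the four rings listed. $\mathbb{H}_3(R)$ denotes the group of $3\times 3$ matrices $\begin{pmatrix}1&b&c\\0&1&a\\0&0&1\end{pmatrix}$ with $a,b,c\in R$, under matrix multiplication. $\mathrm{H}^2(G,\mathbb{C}^\times)$ is the second cohomology group of $G$ with trivial action on $\mathbb{C}^\times$ (the Schur multiplier of $G$). *)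

theory Defs
  imports
    "HOL-Algebra.Algebra"
    "HOL-Number_Theory.Residues"
    "HOL-Analysis.Finite_Cartesian_Product"
begin

text \<open>
  Group cohomology in degree two with trivial action, by inhomogeneous (bar) cochains.
  Cochains are extensional, so that equality of functions is equality on the carrier;
  cocycles are not required to be normalized.
\<close>

definition two_cocycles :: "('g, 'm) monoid_scheme \<Rightarrow> ('a, 'n) monoid_scheme \<Rightarrow> ('g \<times> 'g \<Rightarrow> 'a) set"
  where "two_cocycles G A =
    {f \<in> carrier G \<times> carrier G \<rightarrow>\<^sub>E carrier A.
       \<forall>x\<in>carrier G. \<forall>y\<in>carrier G. \<forall>z\<in>carrier G.
         f (y, z) \<otimes>\<^bsub>A\<^esub> f (x, y \<otimes>\<^bsub>G\<^esub> z) = f (x \<otimes>\<^bsub>G\<^esub> y, z) \<otimes>\<^bsub>A\<^esub> f (x, y)}"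

definition two_cocycle_group :: "('g, 'm) monoid_scheme \<Rightarrow> ('a, 'n) monoid_scheme \<Rightarrow> ('g \<times> 'g \<Rightarrow> 'a) monoid"
  where "two_cocycle_group G A =
    (product_group (carrier G \<times> carrier G) (\<lambda>_. A)) \<lparr>carrier := two_cocycles G A\<rparr>"

definition one_coboundary :: "('g, 'm) monoid_scheme \<Rightarrow> ('a, 'n) monoid_scheme \<Rightarrow> ('g \<Rightarrow> 'a) \<Rightarrow> 'g \<times> 'g \<Rightarrow> 'a"
  where "one_coboundary G A \<phi> =
    (\<lambda>(x, y) \<in> carrier G \<times> carrier G. \<phi> x \<otimes>\<^bsub>A\<^esub> \<phi> y \<otimes>\<^bsub>A\<^esub> inv\<^bsub>A\<^esub> \<phi> (x \<otimes>\<^bsub>G\<^esub> y))"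

definition two_coboundaries :: "('g, 'm) monoid_scheme \<Rightarrow> ('a, 'n) monoid_scheme \<Rightarrow> ('g \<times> 'g \<Rightarrow> 'a) set"
  where "two_coboundaries G A = one_coboundary G A ` (carrier G \<rightarrow>\<^sub>E carrier A)"

definition H2 :: "('g, 'm) monoid_scheme \<Rightarrow> ('a, 'n) monoid_scheme \<Rightarrow> ('g \<times> 'g \<Rightarrow> 'a) set monoid"
  where "H2 G A = two_cocycle_group G A Mod two_coboundaries G A"

definition complex_units :: "complex monoid"
  where "complex_units = \<lparr>carrier = UNIV - {0}, monoid.mult = (*), one = 1\<rparr>"

definition matrix_mult :: "('a, 'm) ring_scheme \<Rightarrow> 'a^'n^'n \<Rightarrow> 'a^'n^'n \<Rightarrow> 'a^'n^'n"
  where "matrix_mult R A B = (\<chi> i j. \<Oplus>\<^bsub>R\<^esub>k\<in>UNIV. A $ i $ k \<otimes>\<^bsub>R\<^esub> B $ k $ j)"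

text \<open>
  The matrix with rows (1, b, c), (0, 1, a), (0, 0, 1).  The index type \<open>3\<close> has the
  elements 1, 2, 3 (with 3 = 0).
\<close>

definition heisenberg_matrix :: "('a, 'm) ring_scheme \<Rightarrow> 'a \<Rightarrow> 'a \<Rightarrow> 'a \<Rightarrow> 'a^3^3"
  where "heisenberg_matrix R a b c =
    (\<chi> i j. if i = j then \<one>\<^bsub>R\<^esub>
            else if i = 1 \<and> j = 2 then b
            else if i = 1 \<and> j = 3 then c
            else if i = 2 \<and> j = 3 then a
            else \<zero>\<^bsub>R\<^esub>)"

definition heisenberg_group :: "('a, 'm) ring_scheme \<Rightarrow> ('a^3^3) monoid"
  where "heisenberg_group R =
    \<lparr>carrier = {heisenberg_matrix R a b c | a b c. a \<in> carrier R \<and> b \<in> carrier R \<and> c \<in> carrier R},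
     monoid.mult = matrix_mult R,
     one = heisenberg_matrix R \<zero>\<^bsub>R\<^esub> \<zero>\<^bsub>R\<^esub> \<zero>\<^bsub>R\<^esub>\<rparr>"

text \<open>\<open>K[t]/(t^2)\<close>\<close>

definition dual_numbers :: "('a, 'm) ring_scheme \<Rightarrow> 'a list set ring"
  where "dual_numbers K =
    poly_ring K Quot (PIdl\<^bsub>poly_ring K\<^esub> (X\<^bsub>K\<^esub> [^]\<^bsub>poly_ring K\<^esub> (2::nat)))"

end

theory Submission
  imports Defs "HOL-Analysis.Complex_Transcendental" "HOL-Analysis.Cartesian_Space"
begin

text \<open>Write \<open>x\<^sub>a\<close>, \<open>y\<^sub>b\<close>, \<open>z\<^sub>c\<close> for the unitriangular matrices with the single entry \<open>a\<close>, \<open>b\<close> or \<open>c\<close>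
  above the diagonal, so that \<open>y\<^sub>b x\<^sub>a = x\<^sub>a y\<^sub>b z\<^sub>b\<^sub>a\<close> is the only relation besides additivity and
  centrality of the \<open>z\<^sub>c\<close>.

  All four rings are free \<open>\<int>/n\<close>-modules with a basis that contains the unit: of rank \<open>r = 1\<close> with
  \<open>n = p\<^sup>2\<close> for \<open>\<int>/p\<^sup>2\<close>, of rank \<open>r = 2\<close> with \<open>n = p\<close> for the other three, where \<open>p \<cdot> 1 = 0\<close>.  For
  every commutative ring with such a basis and \<open>n\<close> odd, the multiplier is \<open>(\<int>/n)\<close> to the power
  \<open>2r\<^sup>2\<close>; this is \<open>H2_heisenberg_group\<close>, and the theorem is its two instances.

  A cocycle \<open>f\<close> is a central extension of the Heisenberg group by \<open>\<complex>\<^sup>\<times>\<close>.  For commuting \<open>x\<close> and \<open>y\<close>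
  the commutator of lifts is the scalar \<open>f(x, y) / f(y, x)\<close>.  It is blind to coboundaries,
  multiplicative in both arguments, and invariant under conjugation.  These three properties
  determine the class of \<open>f\<close> up to one last piece, as follows.

  \<^item> Between \<open>z\<^sub>c\<close> and \<open>x\<^sub>a\<close>, conjugation by the \<open>y\<^sub>b\<close> forces the scalar to depend on the product
    \<open>ca\<close> alone, so it is a character of \<open>R\<close>; likewise between \<open>y\<^sub>b\<close> and \<open>z\<^sub>c\<close>.  A character has
    \<open>r\<close> parameters in \<open>\<int>/n\<close>.
  \<^item> Among the \<open>x\<^sub>a\<close>, and among the \<open>y\<^sub>b\<close>, it is an alternating bicharacter, with \<open>r(r - 1)/2\<close>
    parameters.
  \<^item> If all these scalars are 1, then lifts of the \<open>z\<^sub>c\<close> are central, \<open>a \<mapsto> x\<^sub>a\<close> and \<open>b \<mapsto> y\<^sub>b\<close> lift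
    to homomorphisms (a symmetric cocycle on \<open>R\<close> is a coboundary, because complex numbers have
    roots), and the commutator \<open>\<gamma>(b, a)\<close> of these lifts lies over \<open>z\<^sub>b\<^sub>a\<close>.  The ratio
    \<open>\<kappa>(b, a) = \<gamma>(b, a) / \<gamma>(1, ba)\<close> is a scalar, a bicharacter with \<open>\<kappa>(1, \<cdot>) = 1\<close>, and the extension
    splits up to \<open>\<kappa>\<close>.  It has \<open>r(r - 1)\<close> parameters.

  The total is \<open>2r + r(r - 1) + r(r - 1) = 2r\<^sup>2\<close>.  All parameters occur: characters applied to
  \<open>c a' + b a'\<^sup>2/2\<close> and to \<open>b c' + b\<^sup>2 a'/2\<close>, and bicharacters applied to \<open>(a, a')\<close>, \<open>(b, b')\<close> and
  \<open>(b, a')\<close>, are cocycles; halving is possible because \<open>n\<close> is odd.  The same invariants show that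
  a product of such cocycles is a coboundary only if all its parameters vanish.\<close>


section \<open>Complex-valued cocycles and their classes\<close>

lemma complex_units_simps [simp]:
  "carrier complex_units = UNIV - {0}"
  "x \<otimes>\<^bsub>complex_units\<^esub> y = x * y"
  "\<one>\<^bsub>complex_units\<^esub> = 1"
  by (simp_all add: complex_units_def)

lemma comm_group_complex_units: "comm_group complex_units"
proof (rule comm_groupI)
  fix x assume "x \<in> carrier complex_units"
  then show "\<exists>y\<in>carrier complex_units. y \<otimes>\<^bsub>complex_units\<^esub> x = \<one>\<^bsub>complex_units\<^esub>"
    by (intro bexI[of _ "inverse x"]) auto
qed (auto simp: mult_ac)

lemma inv_complex_units [simp]: "x \<noteq> 0 \<Longrightarrow> inv\<^bsub>complex_units\<^esub> x = inverse x"
  using comm_group_complex_units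
  by (intro group.inv_equality) (auto simp: comm_group_def)

text \<open>Curried versions of the cocycle and coboundary conditions that look only at values on the
  carrier; the extensionality required of elements of \<open>two_cocycles\<close> is dealt with once, when
  the group \<open>H2\<close> is assembled.\<close>

definition is_cocycle :: "('g, 'm) monoid_scheme \<Rightarrow> ('g \<Rightarrow> 'g \<Rightarrow> complex) \<Rightarrow> bool" where
  "is_cocycle G f \<longleftrightarrow> (\<forall>x\<in>carrier G. \<forall>y\<in>carrier G. f x y \<noteq> 0) \<and>
     (\<forall>x\<in>carrier G. \<forall>y\<in>carrier G. \<forall>z\<in>carrier G.
        f y z * f x (y \<otimes>\<^bsub>G\<^esub> z) = f (x \<otimes>\<^bsub>G\<^esub> y) z * f x y)"

definition is_coboundary :: "('g, 'm) monoid_scheme \<Rightarrow> ('g \<Rightarrow> 'g \<Rightarrow> complex) \<Rightarrow> bool" where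
  "is_coboundary G f \<longleftrightarrow> (\<exists>\<phi>. (\<forall>x\<in>carrier G. \<phi> x \<noteq> 0) \<and>
     (\<forall>x\<in>carrier G. \<forall>y\<in>carrier G. f x y = \<phi> x * \<phi> y / \<phi> (x \<otimes>\<^bsub>G\<^esub> y)))"

lemma is_cocycleI:
  assumes "\<And>x y. x \<in> carrier G \<Longrightarrow> y \<in> carrier G \<Longrightarrow> f x y \<noteq> 0"
    and "\<And>x y z. x \<in> carrier G \<Longrightarrow> y \<in> carrier G \<Longrightarrow> z \<in> carrier G \<Longrightarrow>
           f y z * f x (y \<otimes>\<^bsub>G\<^esub> z) = f (x \<otimes>\<^bsub>G\<^esub> y) z * f x y"
  shows "is_cocycle G f"
  using assms by (simp add: is_cocycle_def)

lemma cocycle_nonzero: "is_cocycle G f \<Longrightarrow> x \<in> carrier G \<Longrightarrow> y \<in> carrier G \<Longrightarrow> f x y \<noteq> 0"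
  by (simp add: is_cocycle_def)

lemma cocycle_identity:
  "is_cocycle G f \<Longrightarrow> x \<in> carrier G \<Longrightarrow> y \<in> carrier G \<Longrightarrow> z \<in> carrier G \<Longrightarrow>
    f y z * f x (y \<otimes>\<^bsub>G\<^esub> z) = f (x \<otimes>\<^bsub>G\<^esub> y) z * f x y"
  by (simp add: is_cocycle_def)

lemma is_cocycle_mult:
  assumes "is_cocycle K f" "is_cocycle K g"
  shows "is_cocycle K (\<lambda>x y. f x y * g x y)"
proof (rule is_cocycleI)
  fix x y z assume c: "x \<in> carrier K" "y \<in> carrier K" "z \<in> carrier K"
  have "(f y z * f x (y \<otimes>\<^bsub>K\<^esub> z)) * (g y z * g x (y \<otimes>\<^bsub>K\<^esub> z)) =
      (f (x \<otimes>\<^bsub>K\<^esub> y) z * f x y) * (g (x \<otimes>\<^bsub>K\<^esub> y) z * g x y)"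
    using cocycle_identity[OF assms(1) c] cocycle_identity[OF assms(2) c] by simp
  then show "f y z * g y z * (f x (y \<otimes>\<^bsub>K\<^esub> z) * g x (y \<otimes>\<^bsub>K\<^esub> z)) =
      f (x \<otimes>\<^bsub>K\<^esub> y) z * g (x \<otimes>\<^bsub>K\<^esub> y) z * (f x y * g x y)"
    by (simp add: mult_ac)
qed (use assms in \<open>auto simp: is_cocycle_def\<close>)

lemma is_cocycle_divide:
  assumes "is_cocycle G f" "is_cocycle G g"
  shows "is_cocycle G (\<lambda>x y. f x y / g x y)"
proof (rule is_cocycleI)
  fix x y z assume c: "x \<in> carrier G" "y \<in> carrier G" "z \<in> carrier G"
  then show "f y z / g y z * (f x (y \<otimes>\<^bsub>G\<^esub> z) / g x (y \<otimes>\<^bsub>G\<^esub> z)) =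
      f (x \<otimes>\<^bsub>G\<^esub> y) z / g (x \<otimes>\<^bsub>G\<^esub> y) z * (f x y / g x y)"
    using cocycle_identity[OF assms(1) c] cocycle_identity[OF assms(2) c]
    by (simp only: times_divide_times_eq)
qed (use assms in \<open>auto simp: is_cocycle_def\<close>)

lemma is_coboundary_mult:
  assumes "is_coboundary G f" "is_coboundary G g"
  shows "is_coboundary G (\<lambda>x y. f x y * g x y)"
proof -
  from assms obtain \<phi> \<psi> where
    "(\<forall>x\<in>carrier G. \<phi> x \<noteq> 0)" "(\<forall>x\<in>carrier G. \<psi> x \<noteq> 0)"
    "\<forall>x\<in>carrier G. \<forall>y\<in>carrier G. f x y = \<phi> x * \<phi> y / \<phi> (x \<otimes>\<^bsub>G\<^esub> y)"
    "\<forall>x\<in>carrier G. \<forall>y\<in>carrier G. g x y = \<psi> x * \<psi> y / \<psi> (x \<otimes>\<^bsub>G\<^esub> y)"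
    unfolding is_coboundary_def by auto
  then show ?thesis unfolding is_coboundary_def
    by (intro exI[of _ "\<lambda>x. \<phi> x * \<psi> x"]) (auto simp: mult_ac)
qed

lemma is_coboundary_divide:
  assumes "is_coboundary G f" "is_coboundary G g"
  shows "is_coboundary G (\<lambda>x y. f x y / g x y)"
proof -
  from assms obtain \<phi> \<psi> where
    "(\<forall>x\<in>carrier G. \<phi> x \<noteq> 0)" "(\<forall>x\<in>carrier G. \<psi> x \<noteq> 0)"
    "\<forall>x\<in>carrier G. \<forall>y\<in>carrier G. f x y = \<phi> x * \<phi> y / \<phi> (x \<otimes>\<^bsub>G\<^esub> y)"
    "\<forall>x\<in>carrier G. \<forall>y\<in>carrier G. g x y = \<psi> x * \<psi> y / \<psi> (x \<otimes>\<^bsub>G\<^esub> y)"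
    unfolding is_coboundary_def by auto
  then show ?thesis unfolding is_coboundary_def
    by (intro exI[of _ "\<lambda>x. \<phi> x / \<psi> x"]) (auto simp: mult_ac)
qed

lemma coboundary_imp_cocycle:
  assumes "monoid G" "is_coboundary G f" shows "is_cocycle G f"
proof -
  interpret monoid G by fact
  from assms obtain \<phi> where "(\<forall>x\<in>carrier G. \<phi> x \<noteq> 0)"
    "\<forall>x\<in>carrier G. \<forall>y\<in>carrier G. f x y = \<phi> x * \<phi> y / \<phi> (x \<otimes>\<^bsub>G\<^esub> y)"
    unfolding is_coboundary_def by auto
  then show ?thesis
    by (intro is_cocycleI) (auto simp: m_assoc)
qed

lemma two_cocycles_complex_units:
  "f \<in> two_cocycles G complex_units \<longleftrightarrow>
     f \<in> extensional (carrier G \<times> carrier G) \<and> is_cocycle G (\<lambda>x y. f (x, y))"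
  by (auto simp: two_cocycles_def is_cocycle_def PiE_iff)

lemma two_coboundaries_complex_units:
  assumes "monoid G"
  shows "f \<in> two_coboundaries G complex_units \<longleftrightarrow>
     f \<in> extensional (carrier G \<times> carrier G) \<and> is_coboundary G (\<lambda>x y. f (x, y))"
proof
  interpret monoid G by fact
  assume "f \<in> two_coboundaries G complex_units"
  then obtain \<phi> where \<phi>: "\<phi> \<in> carrier G \<rightarrow>\<^sub>E carrier complex_units"
    and f: "f = one_coboundary G complex_units \<phi>"
    by (auto simp: two_coboundaries_def)
  from \<phi> show "f \<in> extensional (carrier G \<times> carrier G) \<and> is_coboundary G (\<lambda>x y. f (x, y))"
    unfolding is_coboundary_def f one_coboundary_def
    by (auto intro!: exI[of _ \<phi>] simp: PiE_iff divide_inverse)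
next
  interpret monoid G by fact
  assume "f \<in> extensional (carrier G \<times> carrier G) \<and> is_coboundary G (\<lambda>x y. f (x, y))"
  then obtain \<phi> where ext: "f \<in> extensional (carrier G \<times> carrier G)"
    and \<phi>: "\<forall>x\<in>carrier G. \<phi> x \<noteq> 0"
    "\<forall>x\<in>carrier G. \<forall>y\<in>carrier G. f (x, y) = \<phi> x * \<phi> y / \<phi> (x \<otimes>\<^bsub>G\<^esub> y)"
    unfolding is_coboundary_def by auto
  have "f = one_coboundary G complex_units (restrict \<phi> (carrier G))"
  proof (rule extensionalityI[OF ext])
    fix xy assume "xy \<in> carrier G \<times> carrier G"
    then show "f xy = one_coboundary G complex_units (restrict \<phi> (carrier G)) xy"
      using \<phi> by (auto simp: one_coboundary_def divide_inverse)
  qed (simp add: one_coboundary_def)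
  moreover have "restrict \<phi> (carrier G) \<in> carrier G \<rightarrow>\<^sub>E carrier complex_units"
    using \<phi> by auto
  ultimately show "f \<in> two_coboundaries G complex_units"
    by (auto simp: two_coboundaries_def)
qed

lemma comm_group_two_cocycle_group:
  assumes "monoid G"
  shows "comm_group (two_cocycle_group G complex_units)"
proof -
  interpret G: monoid G by fact
  let ?S = "carrier G \<times> carrier G"
  let ?Z = "two_cocycle_group G complex_units"
  have carr: "carrier ?Z = two_cocycles G complex_units"
    and mult: "f \<otimes>\<^bsub>?Z\<^esub> g = (\<lambda>xy\<in>?S. f xy * g xy)"
    and one: "\<one>\<^bsub>?Z\<^esub> = (\<lambda>xy\<in>?S. 1)" for f g
    by (simp_all add: two_cocycle_group_def)
  show ?thesis
  proof (rule comm_groupI; unfold carr mult one two_cocycles_complex_units)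
    fix f assume f: "f \<in> extensional ?S \<and> is_cocycle G (\<lambda>x y. f (x, y))"
    show "(\<lambda>xy\<in>?S. (\<lambda>xy\<in>?S. 1) xy * f xy) = f"
      using f by (intro extensionalityI[of _ ?S]) auto
    show "\<exists>g\<in>two_cocycles G complex_units. (\<lambda>xy\<in>?S. g xy * f xy) = (\<lambda>xy\<in>?S. 1)"
    proof
      show "(\<lambda>xy\<in>?S. inverse (f xy)) \<in> two_cocycles G complex_units"
        using f unfolding two_cocycles_complex_units is_cocycle_def
        by (simp flip: inverse_mult_distrib)
    qed (use f in \<open>auto simp: is_cocycle_def fun_eq_iff restrict_def\<close>)
  next
    fix f g
    assume "f \<in> extensional ?S \<and> is_cocycle G (\<lambda>x y. f (x, y))"
      and "g \<in> extensional ?S \<and> is_cocycle G (\<lambda>x y. g (x, y))"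
    then have f: "is_cocycle G (\<lambda>x y. f (x, y))" and g: "is_cocycle G (\<lambda>x y. g (x, y))" by auto
    have "is_cocycle G (\<lambda>x y. (\<lambda>xy\<in>?S. f xy * g xy) (x, y))"
      using is_cocycle_mult[OF f g] by (simp add: is_cocycle_def)
    then show "(\<lambda>xy\<in>?S. f xy * g xy) \<in> extensional ?S \<and>
        is_cocycle G (\<lambda>x y. (\<lambda>xy\<in>?S. f xy * g xy) (x, y))" by simp
  qed (auto simp: is_cocycle_def mult_ac fun_eq_iff)
qed

lemma subgroup_two_coboundaries:
  assumes "monoid G"
  shows "subgroup (two_coboundaries G complex_units) (two_cocycle_group G complex_units)"
proof -
  interpret G: monoid G by fact
  let ?S = "carrier G \<times> carrier G"
  let ?Z = "two_cocycle_group G complex_units"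
  interpret Z: comm_group ?Z by (rule comm_group_two_cocycle_group) fact
  have carr: "carrier ?Z = two_cocycles G complex_units"
    and mult: "f \<otimes>\<^bsub>?Z\<^esub> g = (\<lambda>xy\<in>?S. f xy * g xy)"
    and one: "\<one>\<^bsub>?Z\<^esub> = (\<lambda>xy\<in>?S. 1)" for f g
    by (simp_all add: two_cocycle_group_def)
  have restr: "is_coboundary G (\<lambda>x y. restrict h ?S (x, y)) \<longleftrightarrow> is_coboundary G (\<lambda>x y. h (x, y))" for h
    by (simp add: is_coboundary_def)
  show ?thesis
  proof (rule Z.subgroupI)
    show sub: "two_coboundaries G complex_units \<subseteq> carrier ?Z"
      using coboundary_imp_cocycle[OF assms]
      by (auto simp: carr two_cocycles_complex_units two_coboundaries_complex_units[OF assms])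
    have triv: "is_coboundary G (\<lambda>x y. 1)"
      unfolding is_coboundary_def by (intro exI[of _ "\<lambda>_. 1"]) auto
    then have "(\<lambda>xy\<in>?S. 1) \<in> two_coboundaries G complex_units"
      by (simp add: two_coboundaries_complex_units[OF assms] restr del: restrict_apply)
    then show "two_coboundaries G complex_units \<noteq> {}" by auto
    fix f assume f: "f \<in> two_coboundaries G complex_units"
    then have f': "is_coboundary G (\<lambda>x y. f (x, y))" "f \<in> carrier ?Z"
      using sub by (auto simp: two_coboundaries_complex_units[OF assms])
    have inv: "inv\<^bsub>?Z\<^esub> f = (\<lambda>xy\<in>?S. 1 / f xy)"
    proof (rule Z.inv_equality[OF _ f'(2)])
      show "(\<lambda>xy\<in>?S. 1 / f xy) \<otimes>\<^bsub>?Z\<^esub> f = \<one>\<^bsub>?Z\<^esub>"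
        using f'(2) by (auto simp: carr mult one two_cocycles_complex_units is_cocycle_def fun_eq_iff)
      show "(\<lambda>xy\<in>?S. 1 / f xy) \<in> carrier ?Z"
        using coboundary_imp_cocycle[OF assms is_coboundary_divide[OF triv f'(1)]]
        by (simp add: carr two_cocycles_complex_units is_cocycle_def)
    qed
    show "inv\<^bsub>?Z\<^esub> f \<in> two_coboundaries G complex_units"
      using is_coboundary_divide[OF triv f'(1)]
      by (simp add: inv two_coboundaries_complex_units[OF assms] restr del: restrict_apply)
    fix g assume g: "g \<in> two_coboundaries G complex_units"
    then show "f \<otimes>\<^bsub>?Z\<^esub> g \<in> two_coboundaries G complex_units"
      using f is_coboundary_mult[of G "\<lambda>x y. f (x, y)" "\<lambda>x y. g (x, y)"]
      by (simp add: mult two_coboundaries_complex_units[OF assms] restr del: restrict_apply)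
  qed
qed

text \<open>The form in which \<open>H2\<close> is computed: a family of cocycles that is additive and \<open>n\<close>-periodic in
  integer parameters gives a homomorphism from a power of \<open>\<int>/n\<close> to \<open>H2\<close>, and the last two
  hypotheses are its injectivity and surjectivity.\<close>

theorem H2_iso_product_group:
  fixes F :: "('i \<Rightarrow> int) \<Rightarrow> 'g \<Rightarrow> 'g \<Rightarrow> complex"
  assumes "group G" and "n > 0"
    and cocycle: "\<And>v. is_cocycle G (F v)"
    and add: "\<And>v w x y. x \<in> carrier G \<Longrightarrow> y \<in> carrier G \<Longrightarrow> F (\<lambda>i. v i + w i) x y = F v x y * F w x y"
    and periodic: "\<And>v w x y. x \<in> carrier G \<Longrightarrow> y \<in> carrier G \<Longrightarrow>
                   (\<forall>i\<in>I. v i mod int n = w i mod int n) \<Longrightarrow> F v x y = F w x y"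
    and inj: "\<And>v i. is_coboundary G (F v) \<Longrightarrow> i \<in> I \<Longrightarrow> int n dvd v i"
    and surj: "\<And>f. is_cocycle G f \<Longrightarrow> \<exists>v. is_coboundary G (\<lambda>x y. f x y / F v x y)"
  shows "H2 G complex_units \<cong> product_group I (\<lambda>_. integer_mod_group n)"
proof -
  interpret G: group G by fact
  let ?S = "carrier G \<times> carrier G"
  let ?Z = "two_cocycle_group G complex_units"
  let ?B = "two_coboundaries G complex_units"
  let ?P = "product_group I (\<lambda>_. integer_mod_group n)"
  interpret Z: comm_group ?Z by (rule comm_group_two_cocycle_group) unfold_locales
  have carr: "carrier ?Z = two_cocycles G complex_units"
    and mult: "f \<otimes>\<^bsub>?Z\<^esub> g = (\<lambda>xy\<in>?S. f xy * g xy)" for f g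
    by (simp_all add: two_cocycle_group_def)
  have B: "subgroup ?B ?Z" by (rule subgroup_two_coboundaries) unfold_locales
  interpret B: normal ?B ?Z by (rule Z.subgroup_imp_normal) (rule B)
  have B_iff: "f \<in> ?B \<longleftrightarrow> f \<in> extensional ?S \<and> is_coboundary G (\<lambda>x y. f (x, y))" for f
    by (rule two_coboundaries_complex_units) unfold_locales
  define F' where "F' = (\<lambda>v. \<lambda>(x, y)\<in>?S. F v x y)"
  define \<Theta> where "\<Theta> = (\<lambda>v. ?B #>\<^bsub>?Z\<^esub> F' v)"
  have F'_in: "F' v \<in> carrier ?Z" for v
    using cocycle[of v] by (simp add: carr two_cocycles_complex_units F'_def is_cocycle_def)
  have \<Theta>_hom: "\<Theta> \<in> hom ?P (?Z Mod ?B)"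
  proof (rule homI)
    show "\<Theta> v \<in> carrier (?Z Mod ?B)" for v
      using F'_in by (auto simp: FactGroup_def \<Theta>_def RCOSETS_def)
    fix v w assume "v \<in> carrier ?P" "w \<in> carrier ?P"
    have "F' (v \<otimes>\<^bsub>?P\<^esub> w) = F' v \<otimes>\<^bsub>?Z\<^esub> F' w"
    proof -
      have "F (v \<otimes>\<^bsub>?P\<^esub> w) x y = F v x y * F w x y" if "x \<in> carrier G" "y \<in> carrier G" for x y
        unfolding add[OF that, symmetric] by (rule periodic[OF that]) simp
      then show ?thesis by (auto simp: F'_def mult fun_eq_iff)
    qed
    then show "\<Theta> (v \<otimes>\<^bsub>?P\<^esub> w) = \<Theta> v \<otimes>\<^bsub>?Z Mod ?B\<^esub> \<Theta> w"
      using B.rcos_sum[OF F'_in F'_in] by (simp add: \<Theta>_def FactGroup_def)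
  qed
  have "group ?P" by simp
  moreover have "group (?Z Mod ?B)" by (rule B.factorgroup_is_group)
  ultimately interpret \<Theta>: group_hom ?P "?Z Mod ?B" \<Theta>
    using \<Theta>_hom by (simp add: group_hom_def group_hom_axioms_def)
  have "v = \<one>\<^bsub>?P\<^esub>" if v: "v \<in> carrier ?P" "\<Theta> v = \<one>\<^bsub>?Z Mod ?B\<^esub>" for v
  proof -
    from v(2) have "F' v \<in> ?B"
      using Z.coset_join1[OF _ F'_in B.is_subgroup] by (simp add: \<Theta>_def FactGroup_def)
    then have "is_coboundary G (F v)"
      by (simp add: B_iff F'_def is_coboundary_def)
    then have dvd: "int n dvd v i" if "i \<in> I" for i using inj that by blast
    have "v i = 0" if "i \<in> I" for i
    proof -
      have "v i \<in> {0..<int n}" using v(1) that \<open>n > 0\<close>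
        by (auto simp: carrier_integer_mod_group PiE_iff)
      with dvd[OF that] show ?thesis
        by (simp add: dvd_eq_mod_eq_0)
    qed
    then show ?thesis using v(1) by (intro extensionalityI[of _ I]) (auto simp: PiE_iff)
  qed
  then have "inj_on \<Theta> (carrier ?P)"
    unfolding \<Theta>.inj_on_one_iff by blast
  moreover have "\<Theta> ` carrier ?P = carrier (?Z Mod ?B)"
  proof
    show "\<Theta> ` carrier ?P \<subseteq> carrier (?Z Mod ?B)" by auto
    show "carrier (?Z Mod ?B) \<subseteq> \<Theta> ` carrier ?P"
    proof
      fix C assume "C \<in> carrier (?Z Mod ?B)"
      then obtain f where f: "f \<in> carrier ?Z" "C = ?B #>\<^bsub>?Z\<^esub> f"
        by (auto simp: FactGroup_def RCOSETS_def)
      then have ext: "f \<in> extensional ?S" and coc: "is_cocycle G (\<lambda>x y. f (x, y))"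
        by (auto simp: carr two_cocycles_complex_units)
      from surj[OF coc] obtain v where v: "is_coboundary G (\<lambda>x y. f (x, y) / F v x y)" by blast
      define w where "w = (\<lambda>i\<in>I. v i mod int n)"
      have w: "w \<in> carrier ?P" using \<open>n > 0\<close>
        by (auto simp: w_def carrier_integer_mod_group)
      have Fw: "F w x y = F v x y" if "x \<in> carrier G" "y \<in> carrier G" for x y
        by (rule periodic[OF that]) (simp add: w_def)
      define b where "b = (\<lambda>(x, y)\<in>?S. f (x, y) / F v x y)"
      have "b \<in> ?B" using v by (simp add: B_iff b_def is_coboundary_def)
      moreover have "b \<otimes>\<^bsub>?Z\<^esub> F' w = f"
        using ext cocycle_nonzero[OF cocycle]
        by (intro extensionalityI[of _ ?S]) (auto simp: mult b_def F'_def Fw)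
      ultimately have "f \<in> ?B #>\<^bsub>?Z\<^esub> F' w" by (auto simp: r_coset_def)
      then have "C = \<Theta> w"
        using Z.repr_independence[OF _ F'_in B.is_subgroup] f by (simp add: \<Theta>_def)
      with w show "C \<in> \<Theta> ` carrier ?P" by blast
    qed
  qed
  ultimately have "\<Theta> \<in> iso ?P (?Z Mod ?B)"
    using \<Theta>_hom by (simp add: iso_def bij_betw_def)
  then have "?P \<cong> H2 G complex_units" unfolding H2_def by (rule is_isoI)
  then show ?thesis by (simp add: group.iso_sym)
qed

lemma product_group_reindex:
  assumes h: "bij_betw h J I"
  shows "product_group I (\<lambda>_. A) \<cong> product_group J (\<lambda>_. A)"
proof -
  let ?\<Theta> = "\<lambda>f. \<lambda>j\<in>J. f (h j)"
  have hJ: "h j \<in> I" if "j \<in> J" for j using h that by (auto simp: bij_betw_def)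
  have "?\<Theta> \<in> hom (product_group I (\<lambda>_. A)) (product_group J (\<lambda>_. A))"
    by (rule homI) (auto simp: hJ PiE_iff fun_eq_iff)
  moreover have "bij_betw ?\<Theta> (I \<rightarrow>\<^sub>E carrier A) (J \<rightarrow>\<^sub>E carrier A)"
  proof (rule bij_betw_byWitness[where f' = "\<lambda>g. \<lambda>i\<in>I. g (inv_into J h i)"])
    have inv: "inv_into J h i \<in> J" "h (inv_into J h i) = i" if "i \<in> I" for i
      using h that by (auto simp: bij_betw_def inv_into_into f_inv_into_f)
    have inv': "inv_into J h (h j) = j" if "j \<in> J" for j
      using h that by (simp add: bij_betw_def)
    show "\<forall>f\<in>I \<rightarrow>\<^sub>E carrier A. (\<lambda>i\<in>I. ?\<Theta> f (inv_into J h i)) = f"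
      by (auto intro!: extensionalityI[of _ I] simp: inv PiE_iff)
    show "\<forall>g\<in>J \<rightarrow>\<^sub>E carrier A. ?\<Theta> (\<lambda>i\<in>I. g (inv_into J h i)) = g"
      by (auto intro!: extensionalityI[of _ J] simp: inv' hJ PiE_iff)
    show "?\<Theta> ` (I \<rightarrow>\<^sub>E carrier A) \<subseteq> J \<rightarrow>\<^sub>E carrier A" by (auto simp: hJ PiE_iff)
    show "(\<lambda>g. \<lambda>i\<in>I. g (inv_into J h i)) ` (J \<rightarrow>\<^sub>E carrier A) \<subseteq> I \<rightarrow>\<^sub>E carrier A"
      by (auto simp: inv PiE_iff)
  qed
  ultimately show ?thesis by (intro is_isoI) (simp add: iso_def)
qed


section \<open>The commutator pairing of a cocycle\<close>

text \<open>If \<open>x\<close> and \<open>y\<close> commute, this is the commutator of any two lifts of \<open>x\<close> and \<open>y\<close> to the central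
  extension defined by \<open>f\<close>; hence the rules below.\<close>

definition comm_pairing :: "('g \<Rightarrow> 'g \<Rightarrow> complex) \<Rightarrow> 'g \<Rightarrow> 'g \<Rightarrow> complex" where
  "comm_pairing f x y = f x y / f y x"

lemma comm_pairing_commute: "comm_pairing f y x = inverse (comm_pairing f x y)"
  by (simp add: comm_pairing_def)

lemma comm_pairing_nonzero:
  "is_cocycle G f \<Longrightarrow> x \<in> carrier G \<Longrightarrow> y \<in> carrier G \<Longrightarrow> comm_pairing f x y \<noteq> 0"
  by (simp add: comm_pairing_def cocycle_nonzero)

lemma comm_pairing_self: "is_cocycle G f \<Longrightarrow> x \<in> carrier G \<Longrightarrow> comm_pairing f x x = 1"
  by (simp add: comm_pairing_def cocycle_nonzero)

lemma comm_pairing_divide: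
  "comm_pairing (\<lambda>x y. f x y / g x y) x y = comm_pairing f x y / comm_pairing g x y"
  by (simp add: comm_pairing_def)

lemma comm_pairing_coboundary:
  assumes "is_coboundary G f" "x \<in> carrier G" "y \<in> carrier G" "x \<otimes>\<^bsub>G\<^esub> y = y \<otimes>\<^bsub>G\<^esub> x"
    "x \<otimes>\<^bsub>G\<^esub> y \<in> carrier G"
  shows "comm_pairing f x y = 1"
proof -
  obtain \<phi> where "\<forall>x\<in>carrier G. \<phi> x \<noteq> 0"
    "\<forall>x\<in>carrier G. \<forall>y\<in>carrier G. f x y = \<phi> x * \<phi> y / \<phi> (x \<otimes>\<^bsub>G\<^esub> y)"
    using assms(1) unfolding is_coboundary_def by blast
  then show ?thesis using assms(2-) by (auto simp: comm_pairing_def)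
qed

lemma (in monoid) comm_pairing_mult_right:
  assumes f: "is_cocycle G f" and c: "x \<in> carrier G" "y \<in> carrier G" "z \<in> carrier G"
    and xy: "x \<otimes> y = y \<otimes> x" and xz: "x \<otimes> z = z \<otimes> x"
  shows "comm_pairing f x (y \<otimes> z) = comm_pairing f x y * comm_pairing f x z"
proof -
  note nz = cocycle_nonzero[OF f]
  have 1: "f y z * f x (y \<otimes> z) = f (x \<otimes> y) z * f x y"
    using cocycle_identity[OF f, of x y z] c by simp
  have 2: "f z x * f y (x \<otimes> z) = f (y \<otimes> z) x * f y z"
    using cocycle_identity[OF f, of y z x] c xz by simp
  have 3: "f x z * f y (x \<otimes> z) = f (x \<otimes> y) z * f y x"
    using cocycle_identity[OF f, of y x z] c xy by simp
  have "f x (y \<otimes> z) = f (x \<otimes> y) z * f x y / f y z" using 1 nz c by (simp add: field_simps)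
  moreover have "f (y \<otimes> z) x = f z x * f y (x \<otimes> z) / f y z"
    using 2 nz c by (simp add: field_simps)
  moreover have "f y (x \<otimes> z) = f (x \<otimes> y) z * f y x / f x z"
    using 3 nz c by (simp add: field_simps)
  ultimately show ?thesis
    using nz c by (simp add: comm_pairing_def)
qed

lemma (in monoid) comm_pairing_mult_left:
  assumes f: "is_cocycle G f" and c: "x \<in> carrier G" "y \<in> carrier G" "z \<in> carrier G"
    and xz: "x \<otimes> z = z \<otimes> x" and yz: "y \<otimes> z = z \<otimes> y"
  shows "comm_pairing f (x \<otimes> y) z = comm_pairing f x z * comm_pairing f y z"
  using comm_pairing_mult_right[OF f c(3,1,2)] xz yz
  by (simp add: comm_pairing_commute[of f z] flip: inverse_mult_distrib)

lemma (in monoid) comm_pairing_conj: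
  assumes f: "is_cocycle G f"
    and c: "x \<in> carrier G" "y \<in> carrier G" "x' \<in> carrier G" "y' \<in> carrier G" "g \<in> carrier G"
    and conj: "g \<otimes> x = x' \<otimes> g" "g \<otimes> y = y' \<otimes> g"
    and comm: "x \<otimes> y = y \<otimes> x" "x' \<otimes> y' = y' \<otimes> x'"
  shows "comm_pairing f x' y' = comm_pairing f x y"
proof -
  note nz = cocycle_nonzero[OF f]
  \<comment> \<open>The scalar by which conjugation by a lift of \<open>g\<close> changes the chosen lift of \<open>u\<close>.\<close>
  define d where "d = (\<lambda>u u'. f g u / f u' g)"
  have key: "f u' v' * d u u' * d v v' = f u v * d (u \<otimes> v) (u' \<otimes> v')"
    if uv: "u \<in> carrier G" "v \<in> carrier G" "u' \<in> carrier G" "v' \<in> carrier G"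
      "g \<otimes> u = u' \<otimes> g" "g \<otimes> v = v' \<otimes> g" for u v u' v'
  proof -
    have 1: "f u v * f g (u \<otimes> v) = f (u' \<otimes> g) v * f g u"
      using cocycle_identity[OF f, of g u v] c uv by simp
    have 2: "f g v * f u' (v' \<otimes> g) = f (u' \<otimes> g) v * f u' g"
      using cocycle_identity[OF f, of u' g v] c uv by simp
    have 3: "f v' g * f u' (v' \<otimes> g) = f (u' \<otimes> v') g * f u' v'"
      using cocycle_identity[OF f, of u' v' g] c uv by simp
    have "f g (u \<otimes> v) = f (u' \<otimes> g) v * f g u / f u v"
      using 1 nz c uv by (simp add: field_simps)
    moreover have "f (u' \<otimes> g) v = f g v * f u' (v' \<otimes> g) / f u' g"
      using 2 nz c uv by (simp add: field_simps)
    moreover have "f u' (v' \<otimes> g) = f (u' \<otimes> v') g * f u' v' / f v' g"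
      using 3 nz c uv by (simp add: field_simps)
    ultimately show ?thesis
      using nz c uv by (simp add: d_def mult_ac)
  qed
  have dnz: "d u u' \<noteq> 0" if "u \<in> carrier G" "u' \<in> carrier G" for u u'
    using nz c that by (simp add: d_def)
  from key[of x y x' y'] c conj
  have e1: "f x' y' = f x y * d (x \<otimes> y) (x' \<otimes> y') / (d x x' * d y y')"
    using dnz by (simp add: field_simps)
  from key[of y x y' x'] c conj
  have e2: "f y' x' = f y x * d (x \<otimes> y) (x' \<otimes> y') / (d x x' * d y y')"
    using dnz comm by (simp add: field_simps)
  show ?thesis unfolding comm_pairing_def e1 e2
    using dnz c by simp
qed

section \<open>The central extension of a cocycle\<close>

text \<open>Cocycles are not normalized, so the unit carries the correction \<open>1 / f(1, 1)\<close>.\<close>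

definition cocycle_extension :: "('g, 'm) monoid_scheme \<Rightarrow> ('g \<Rightarrow> 'g \<Rightarrow> complex) \<Rightarrow> (complex \<times> 'g) monoid" where
  "cocycle_extension G f =
     \<lparr>carrier = (UNIV - {0}) \<times> carrier G,
      monoid.mult = (\<lambda>(u, x) (v, y). (u * v * f x y, x \<otimes>\<^bsub>G\<^esub> y)),
      one = (1 / f \<one>\<^bsub>G\<^esub> \<one>\<^bsub>G\<^esub>, \<one>\<^bsub>G\<^esub>)\<rparr>"

lemma cocycle_extension_simps [simp]:
  "carrier (cocycle_extension G f) = (UNIV - {0}) \<times> carrier G"
  "(u, x) \<otimes>\<^bsub>cocycle_extension G f\<^esub> (v, y) = (u * v * f x y, x \<otimes>\<^bsub>G\<^esub> y)"
  "\<one>\<^bsub>cocycle_extension G f\<^esub> = (1 / f \<one>\<^bsub>G\<^esub> \<one>\<^bsub>G\<^esub>, \<one>\<^bsub>G\<^esub>)"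
  by (simp_all add: cocycle_extension_def)

lemma (in monoid) cocycle_one_left:
  assumes "is_cocycle G f" "x \<in> carrier G" shows "f \<one> x = f \<one> \<one>"
  using cocycle_identity[OF assms(1), of \<one> \<one> x] cocycle_nonzero[OF assms(1)] assms(2) by simp

lemma (in group) group_cocycle_extension:
  assumes f: "is_cocycle G f"
  shows "group (cocycle_extension G f)"
proof (rule groupI)
  note nz = cocycle_nonzero[OF f]
  show "a \<otimes>\<^bsub>cocycle_extension G f\<^esub> b \<in> carrier (cocycle_extension G f)"
    if "a \<in> carrier (cocycle_extension G f)" "b \<in> carrier (cocycle_extension G f)" for a b
    using that nz by (cases a; cases b) auto
  show "\<one>\<^bsub>cocycle_extension G f\<^esub> \<in> carrier (cocycle_extension G f)" using nz by auto
  show "a \<otimes>\<^bsub>cocycle_extension G f\<^esub> b \<otimes>\<^bsub>cocycle_extension G f\<^esub> c =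
        a \<otimes>\<^bsub>cocycle_extension G f\<^esub> (b \<otimes>\<^bsub>cocycle_extension G f\<^esub> c)"
    if "a \<in> carrier (cocycle_extension G f)" "b \<in> carrier (cocycle_extension G f)"
       "c \<in> carrier (cocycle_extension G f)" for a b c
  proof (cases a; cases b; cases c)
    fix u x v y w z assume [simp]: "a = (u, x)" "b = (v, y)" "c = (w, z)"
    have c: "x \<in> carrier G" "y \<in> carrier G" "z \<in> carrier G" using that by auto
    show ?thesis using cocycle_identity[OF f c] c by (simp add: m_assoc mult_ac)
  qed
  show "\<one>\<^bsub>cocycle_extension G f\<^esub> \<otimes>\<^bsub>cocycle_extension G f\<^esub> a = a"
    if "a \<in> carrier (cocycle_extension G f)" for a
    using that nz[of \<one> \<one>] cocycle_one_left[OF f, of "snd a"] by (cases a) simp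
  show "\<exists>b\<in>carrier (cocycle_extension G f). b \<otimes>\<^bsub>cocycle_extension G f\<^esub> a = \<one>\<^bsub>cocycle_extension G f\<^esub>"
    if "a \<in> carrier (cocycle_extension G f)" for a
  proof (cases a)
    fix u x assume [simp]: "a = (u, x)"
    show ?thesis using that nz
      by (intro bexI[of _ "(1 / (u * f (inv x) x * f \<one> \<one>), inv x)"]) auto
  qed
qed

text \<open>The point is that a lift can be rescaled by \<open>u\<close> to make its \<open>n\<close>-th power any prescribed scalar.\<close>

lemma cocycle_extension_pow:
  "(u, x) [^]\<^bsub>cocycle_extension G f\<^esub> (k::nat) =
     (u ^ k * fst ((1, x) [^]\<^bsub>cocycle_extension G f\<^esub> k), x [^]\<^bsub>G\<^esub> k)"
proof (induction k)
  case (Suc k)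
  obtain w y where wy: "(1, x) [^]\<^bsub>cocycle_extension G f\<^esub> k = (w, y)" by fastforce
  moreover have "y = x [^]\<^bsub>G\<^esub> k"
    using wy by (induction k arbitrary: w y) (auto split: prod.splits simp: cocycle_extension_def)
  ultimately show ?case using Suc by (simp add: mult_ac)
qed simp

section \<open>Additive coordinates modulo n\<close>

text \<open>A \<open>\<int>/n\<close>-module, written multiplicatively, with generators \<open>e\<close> and additive coordinate functions
  \<open>\<pi>\<close> that expand every element in them.  For a free module these come from a basis, when also the
  coordinates of \<open>e\<close> itself are the unit vectors.  Coordinates are natural numbers of which only
  the class modulo \<open>n\<close> matters, so that they can serve as exponents for lifts of the \<open>e i\<close>, whose
  order is not known in advance.\<close>

locale zn_basis = comm_group B for B (structure) +
  fixes n r :: nat and e :: "nat \<Rightarrow> 'a" and \<pi> :: "nat \<Rightarrow> 'a \<Rightarrow> nat"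
  assumes n_pos: "n > 0"
    and e_closed [simp]: "i < r \<Longrightarrow> e i \<in> carrier B"
    and e_pow_n: "i < r \<Longrightarrow> e i [^] n = \<one>"
    and expansion: "a \<in> carrier B \<Longrightarrow> a = (\<Otimes>i\<in>{..<r}. e i [^] \<pi> i a)"
    and coord_mult: "i < r \<Longrightarrow> a \<in> carrier B \<Longrightarrow> b \<in> carrier B \<Longrightarrow>
                     [\<pi> i (a \<otimes> b) = \<pi> i a + \<pi> i b] (mod n)"

lemma (in monoid) nat_pow_cong:
  assumes "x \<in> carrier G" "x [^] n = \<one>" "[k = l] (mod n)"
  shows "x [^] k = x [^] (l::nat)"
proof -
  have "x [^] k = x [^] (k mod n)" for k
  proof -
    have "x [^] k = x [^] (n * (k div n) + k mod n)" by simp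
    also have "\<dots> = (x [^] n) [^] (k div n) \<otimes> x [^] (k mod n)"
      using assms(1) by (simp only: nat_pow_mult[symmetric] nat_pow_pow)
    finally show ?thesis using assms(1,2) by simp
  qed
  from this[of k] this[of l] assms(3) show ?thesis by (simp add: cong_def)
qed

lemma exists_complex_root:
  assumes "n > 0" "z \<noteq> 0" shows "\<exists>w::complex. w ^ n = z \<and> w \<noteq> 0"
  using assms
  by (intro exI[of _ "exp (Ln z / of_nat n)"]) (simp flip: exp_of_nat_mult)

text \<open>The extension is abelian, so it splits once every basis element has a lift of order
  dividing \<open>n\<close>.  Such a lift exists since \<open>n\<close>-th roots can be taken in \<open>\<complex>\<^sup>\<times>\<close>; products of powers of
  these lifts give the splitting.\<close>

lemma (in zn_basis) symmetric_cocycle_is_coboundary: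
  assumes f: "is_cocycle B f"
    and sym: "\<And>a b. a \<in> carrier B \<Longrightarrow> b \<in> carrier B \<Longrightarrow> f a b = f b a"
  shows "is_coboundary B f"
proof -
  define E where "E = cocycle_extension B f"
  have "group E" unfolding E_def by (rule group_cocycle_extension) fact
  then interpret E: comm_group E
    by (rule group.group_comm_groupI) (auto simp: E_def sym mult_ac m_comm)
  have "\<exists>w. w \<noteq> 0 \<and> (w, e i) [^]\<^bsub>E\<^esub> n = \<one>\<^bsub>E\<^esub>" if i: "i < r" for i
  proof -
    have "(1, e i) [^]\<^bsub>E\<^esub> n \<in> carrier E" by (rule E.nat_pow_closed) (simp add: E_def i)
    then have c: "fst ((1, e i) [^]\<^bsub>E\<^esub> n) \<noteq> 0" by (auto simp: E_def)
    then obtain w where "w ^ n = 1 / f \<one> \<one> / fst ((1, e i) [^]\<^bsub>E\<^esub> n)" "w \<noteq> 0"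
      using exists_complex_root[OF n_pos, of "1 / f \<one> \<one> / fst ((1, e i) [^]\<^bsub>E\<^esub> n)"]
        cocycle_nonzero[OF f, of \<one> \<one>] by auto
    then show ?thesis using c e_pow_n[OF i] cocycle_extension_pow[of B f w "e i" n]
      by (intro exI[of _ w]) (simp add: E_def)
  qed
  then obtain w where w: "\<And>i. i < r \<Longrightarrow> w i \<noteq> 0" "\<And>i. i < r \<Longrightarrow> (w i, e i) [^]\<^bsub>E\<^esub> n = \<one>\<^bsub>E\<^esub>"
    by metis
  have wE: "(w i, e i) \<in> carrier E" if "i < r" for i using that w(1) by (simp add: E_def)
  define T where "T = (\<lambda>a. \<Otimes>\<^bsub>E\<^esub>i\<in>{..<r}. (w i, e i) [^]\<^bsub>E\<^esub> \<pi> i a)"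
  have T_closed: "T a \<in> carrier E" for a
    unfolding T_def by (rule E.finprod_closed) (auto intro: E.nat_pow_closed wE)
  have T_mult: "T a \<otimes>\<^bsub>E\<^esub> T b = T (a \<otimes> b)" if "a \<in> carrier B" "b \<in> carrier B" for a b
  proof -
    have "T a \<otimes>\<^bsub>E\<^esub> T b = (\<Otimes>\<^bsub>E\<^esub>i\<in>{..<r}. (w i, e i) [^]\<^bsub>E\<^esub> \<pi> i a \<otimes>\<^bsub>E\<^esub> (w i, e i) [^]\<^bsub>E\<^esub> \<pi> i b)"
      unfolding T_def by (rule E.finprod_multf[symmetric]) (auto intro: E.nat_pow_closed wE)
    also have "\<dots> = T (a \<otimes> b)"
      unfolding T_def
    proof (rule E.finprod_cong')
      fix i assume "i \<in> {..<r}"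
      then show "(w i, e i) [^]\<^bsub>E\<^esub> \<pi> i a \<otimes>\<^bsub>E\<^esub> (w i, e i) [^]\<^bsub>E\<^esub> \<pi> i b = (w i, e i) [^]\<^bsub>E\<^esub> \<pi> i (a \<otimes> b)"
        using E.nat_pow_cong[OF wE w(2) cong_sym[OF coord_mult[OF _ that]], of i] E.nat_pow_mult[OF wE, of i]
        by simp
    qed (auto intro: E.nat_pow_closed wE)
    finally show ?thesis .
  qed
  have "snd (T a) = a" if "a \<in> carrier B" for a
  proof -
    have "snd (\<Otimes>\<^bsub>E\<^esub>i\<in>{..<m}. (w i, e i) [^]\<^bsub>E\<^esub> \<pi> i a) = (\<Otimes>i\<in>{..<m}. e i [^] \<pi> i a)"
      if "m \<le> r" for m
      using that
    proof (induction m)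
      case (Suc m)
      have snd: "snd (p \<otimes>\<^bsub>E\<^esub> q) = snd p \<otimes> snd q" for p q
        by (cases p; cases q) (simp add: E_def)
      have snd_pow: "snd ((w i, e i) [^]\<^bsub>E\<^esub> (k::nat)) = e i [^] k" for i k
        using cocycle_extension_pow[of B f "w i" "e i" k] by (simp add: E_def)
      have "(\<Otimes>\<^bsub>E\<^esub>i\<in>{..<Suc m}. (w i, e i) [^]\<^bsub>E\<^esub> \<pi> i a) =
            (w m, e m) [^]\<^bsub>E\<^esub> \<pi> m a \<otimes>\<^bsub>E\<^esub> (\<Otimes>\<^bsub>E\<^esub>i\<in>{..<m}. (w i, e i) [^]\<^bsub>E\<^esub> \<pi> i a)"
        unfolding lessThan_Suc using Suc.prems
        by (intro E.finprod_insert) (simp_all add: wE E.nat_pow_closed Pi_iff)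
      moreover have "(\<Otimes>i\<in>{..<Suc m}. e i [^] \<pi> i a) = e m [^] \<pi> m a \<otimes> (\<Otimes>i\<in>{..<m}. e i [^] \<pi> i a)"
        unfolding lessThan_Suc using Suc.prems by (intro finprod_insert) auto
      ultimately show ?case using Suc by (simp add: snd snd_pow)
    next
      case 0
      have "snd \<one>\<^bsub>E\<^esub> = \<one>" by (simp add: E_def)
      then show ?case by simp
    qed
    from this[of r] show ?thesis using expansion[OF that] by (simp add: T_def)
  qed
  then have T: "T a = (fst (T a), a)" if "a \<in> carrier B" for a
    using that by (metis prod.collapse)
  have nz: "fst (T a) \<noteq> 0" for a using T_closed[of a] by (auto simp: E_def)
  have "f a b = (1 / fst (T a)) * (1 / fst (T b)) / (1 / fst (T (a \<otimes> b)))"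
    if "a \<in> carrier B" "b \<in> carrier B" for a b
  proof -
    have "(fst (T a), a) \<otimes>\<^bsub>E\<^esub> (fst (T b), b) = (fst (T (a \<otimes> b)), a \<otimes> b)"
      using T_mult[OF that] T that by (metis m_closed)
    then have "fst (T a) * fst (T b) * f a b = fst (T (a \<otimes> b))" by (simp add: E_def)
    then show ?thesis using nz by (simp add: field_simps)
  qed
  with nz show ?thesis
    unfolding is_coboundary_def by (intro exI[of _ "\<lambda>a. 1 / fst (T a)"]) auto
qed

definition unity_root :: "nat \<Rightarrow> int \<Rightarrow> complex" where
  "unity_root n k = cis (2 * pi * of_int k / of_nat n)"

lemma unity_root_add: "unity_root n (k + l) = unity_root n k * unity_root n l"
  by (simp add: unity_root_def cis_mult add_divide_distrib distrib_left)

lemma unity_root_0 [simp]: "unity_root n 0 = 1"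
  by (simp add: unity_root_def)

lemma unity_root_nonzero [simp]: "unity_root n k \<noteq> 0"
  by (simp add: unity_root_def)

lemma unity_root_minus: "unity_root n (- k) = inverse (unity_root n k)"
  by (simp add: unity_root_def)

lemma unity_root_diff: "unity_root n (k - l) = unity_root n k / unity_root n l"
  using unity_root_add[of n k "- l"] by (simp add: unity_root_minus divide_inverse)

lemma unity_root_eq_1_iff:
  assumes "n > 0" shows "unity_root n k = 1 \<longleftrightarrow> int n dvd k"
proof
  assume "unity_root n k = 1"
  then have "cos (2 * pi * of_int k / of_nat n) = (1::real)"
    by (simp add: unity_root_def complex_eq_iff)
  then obtain m :: int where "2 * pi * real_of_int k / real n = of_int m * 2 * pi"
    by (auto simp: cos_one_2pi_int)
  then have "real_of_int k = of_int (m * int n)" using assms by (simp add: field_simps)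
  then have "k = m * int n" by linarith
  then show "int n dvd k" by simp
next
  assume "int n dvd k"
  then obtain m where "k = int n * m" by blast
  then have "2 * pi * real_of_int k / real n = 2 * pi * real_of_int m" using assms by simp
  then show "unity_root n k = 1" by (simp add: unity_root_def)
qed

lemma unity_root_cong:
  assumes "n > 0" "[k = l] (mod int n)" shows "unity_root n k = unity_root n l"
proof -
  have "unity_root n (k - l) = 1"
    using assms by (simp add: unity_root_eq_1_iff cong_iff_dvd_diff)
  then show ?thesis by (simp add: unity_root_diff)
qed

lemma root_of_unity_eq_unity_root:
  assumes "n > 0" "z ^ n = 1" shows "\<exists>k. z = unity_root n k"
proof -
  have "z \<in> (\<lambda>k. cis (2 * pi * real k / real n)) ` {..<n}"
    using Complex.bij_betw_roots_unity[OF assms(1)] assms(2) by (auto simp: bij_betw_def)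
  then obtain k where "z = cis (2 * pi * real k / real n)" by auto
  then show ?thesis by (intro exI[of _ "int k"]) (simp add: unity_root_def)
qed

context zn_basis
begin

definition character :: "('a \<Rightarrow> complex) \<Rightarrow> bool" where
  "character h \<longleftrightarrow> (\<forall>a\<in>carrier B. h a \<noteq> 0) \<and> (\<forall>a\<in>carrier B. \<forall>b\<in>carrier B. h (a \<otimes> b) = h a * h b)"

definition bicharacter :: "('a \<Rightarrow> 'a \<Rightarrow> complex) \<Rightarrow> bool" where
  "bicharacter \<beta> \<longleftrightarrow> (\<forall>a\<in>carrier B. character (\<beta> a) \<and> character (\<lambda>b. \<beta> b a))"

lemma character_one:
  assumes "character h" shows "h \<one> = 1"
proof -
  have "h (\<one> \<otimes> \<one>) = h \<one> * h \<one>" "h \<one> \<noteq> 0"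
    using assms unfolding character_def by (blast intro: one_closed)+
  then show ?thesis by simp
qed

lemma character_pow:
  assumes "character h" "a \<in> carrier B" shows "h (a [^] (k::nat)) = h a ^ k"
  using assms by (induction k) (simp_all add: character_one[OF assms(1)], simp add: character_def)

lemma character_expansion:
  assumes h: "character h" and a: "a \<in> carrier B"
  shows "h a = (\<Prod>i<r. h (e i) ^ \<pi> i a)"
proof -
  have "h (\<Otimes>i\<in>{..<m}. e i [^] \<pi> i a) = (\<Prod>i<m. h (e i) ^ \<pi> i a)" if "m \<le> r" for m
    using that
  proof (induction m)
    case (Suc m)
    have "(\<Otimes>i\<in>{..<Suc m}. e i [^] \<pi> i a) = e m [^] \<pi> m a \<otimes> (\<Otimes>i\<in>{..<m}. e i [^] \<pi> i a)"
      unfolding lessThan_Suc using Suc.prems by (intro finprod_insert) auto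
    moreover have "(\<Otimes>i\<in>{..<m}. e i [^] \<pi> i a) \<in> carrier B"
      using Suc.prems by (intro finprod_closed) auto
    moreover have "h (x \<otimes> y) = h x * h y" if "x \<in> carrier B" "y \<in> carrier B" for x y
      using h that by (simp add: character_def)
    ultimately show ?case using Suc
      by (simp add: character_pow[OF h])
  qed (simp add: character_one[OF h])
  from this[of r] expansion[OF a] show ?thesis by simp
qed

lemma character_eqI:
  assumes "character h" "character g" "\<And>i. i < r \<Longrightarrow> h (e i) = g (e i)" "a \<in> carrier B"
  shows "h a = g a"
proof -
  have "(\<Prod>i<r. h (e i) ^ \<pi> i a) = (\<Prod>i<r. g (e i) ^ \<pi> i a)"
    by (rule prod.cong) (use assms(3) in auto)
  then show ?thesis
    using character_expansion[OF assms(1,4)] character_expansion[OF assms(2,4)] by metis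
qed

lemma bicharacter_eqI:
  assumes "bicharacter \<beta>" "bicharacter \<gamma>"
    and "\<And>i j. i < r \<Longrightarrow> j < r \<Longrightarrow> \<beta> (e i) (e j) = \<gamma> (e i) (e j)"
    and ab: "a \<in> carrier B" "b \<in> carrier B"
  shows "\<beta> a b = \<gamma> a b"
proof -
  have ch: "character (\<delta> x)" "character (\<lambda>y. \<delta> y x)" if "bicharacter \<delta>" "x \<in> carrier B" for \<delta> x
    using that by (simp_all add: bicharacter_def)
  have "\<beta> a (e j) = \<gamma> a (e j)" if "j < r" for j
    using character_eqI[OF ch(2)[OF assms(1)] ch(2)[OF assms(2)] assms(3)[OF _ that] ab(1)] that
    by simp
  then show ?thesis
    by (rule character_eqI[OF ch(1)[OF assms(1) ab(1)] ch(1)[OF assms(2) ab(1)] _ ab(2)])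
qed

lemma character_basis_value:
  assumes "character h" "i < r" shows "\<exists>k. h (e i) = unity_root n k"
  using root_of_unity_eq_unity_root[OF n_pos, of "h (e i)"] character_pow[OF assms(1), of "e i" n]
  by (simp add: e_pow_n assms(2) character_one[OF assms(1)])

lemma bicharacter_basis_values:
  assumes "bicharacter \<beta>"
  shows "\<exists>u. \<forall>i<r. \<forall>j<r. \<beta> (e i) (e j) = unity_root n (u i j)"
proof -
  have "\<exists>k. \<beta> (e i) (e j) = unity_root n k" if "i < r" "j < r" for i j
    using character_basis_value[of "\<beta> (e i)" j] assms that by (simp add: bicharacter_def)
  then show ?thesis by metis
qed

lemma character_unity_root:
  "character (\<lambda>a. unity_root n (\<Sum>i<r. u i * int (\<pi> i a)))"
  unfolding character_def
proof (intro conjI ballI)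
  fix a b assume ab: "a \<in> carrier B" "b \<in> carrier B"
  have "[int (\<pi> i (a \<otimes> b)) = int (\<pi> i a + \<pi> i b)] (mod int n)" if "i < r" for i
    unfolding cong_int_iff using coord_mult[OF that ab] .
  then have "[(\<Sum>i<r. u i * int (\<pi> i (a \<otimes> b))) = (\<Sum>i<r. u i * int (\<pi> i a + \<pi> i b))] (mod int n)"
    by (intro cong_sum cong_mult cong_refl) auto
  from unity_root_cong[OF n_pos this]
  show "unity_root n (\<Sum>i<r. u i * int (\<pi> i (a \<otimes> b))) =
      unity_root n (\<Sum>i<r. u i * int (\<pi> i a)) * unity_root n (\<Sum>i<r. u i * int (\<pi> i b))"
    by (simp add: unity_root_add[symmetric] sum.distrib distrib_left)
qed auto

lemma bicharacter_unity_root: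
  "bicharacter (\<lambda>a b. unity_root n (\<Sum>i<r. \<Sum>j<r. u i j * int (\<pi> i a) * int (\<pi> j b)))"
proof -
  have "(\<Sum>i<r. \<Sum>j<r. u i j * int (\<pi> i a) * int (\<pi> j b)) =
        (\<Sum>j<r. (\<Sum>i<r. u i j * int (\<pi> i a)) * int (\<pi> j b))" for a b
    by (subst sum.swap) (simp add: sum_distrib_right)
  then have 1: "character (\<lambda>b. unity_root n (\<Sum>i<r. \<Sum>j<r. u i j * int (\<pi> i a) * int (\<pi> j b)))" for a
    using character_unity_root[of "\<lambda>j. \<Sum>i<r. u i j * int (\<pi> i a)"] by simp
  have "(\<Sum>i<r. \<Sum>j<r. u i j * int (\<pi> i a) * int (\<pi> j b)) =
        (\<Sum>i<r. (\<Sum>j<r. u i j * int (\<pi> j b)) * int (\<pi> i a))" for a b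
    by (simp add: sum_distrib_left sum_distrib_right mult_ac)
  then have 2: "character (\<lambda>a. unity_root n (\<Sum>i<r. \<Sum>j<r. u i j * int (\<pi> i a) * int (\<pi> j b)))" for b
    using character_unity_root[of "\<lambda>i. \<Sum>j<r. u i j * int (\<pi> j b)"] by simp
  from 1 2 show ?thesis by (simp add: bicharacter_def)
qed

lemma bicharacter_divide:
  "bicharacter \<beta> \<Longrightarrow> bicharacter \<gamma> \<Longrightarrow> bicharacter (\<lambda>a b. \<beta> a b / \<gamma> a b)"
  by (simp add: bicharacter_def character_def)

lemma bicharacter_flip: "bicharacter \<beta> \<Longrightarrow> bicharacter (\<lambda>a b. \<beta> b a)"
  by (simp add: bicharacter_def)

lemma bicharacterI:
  assumes "\<And>a b. a \<in> carrier B \<Longrightarrow> b \<in> carrier B \<Longrightarrow> \<beta> a b \<noteq> 0"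
    and "\<And>a b c. a \<in> carrier B \<Longrightarrow> b \<in> carrier B \<Longrightarrow> c \<in> carrier B \<Longrightarrow> \<beta> (a \<otimes> b) c = \<beta> a c * \<beta> b c"
    and "\<And>a b c. a \<in> carrier B \<Longrightarrow> b \<in> carrier B \<Longrightarrow> c \<in> carrier B \<Longrightarrow> \<beta> a (b \<otimes> c) = \<beta> a b * \<beta> a c"
  shows "bicharacter \<beta>"
  using assms by (simp add: bicharacter_def character_def)

end

section \<open>The Heisenberg group of a commutative ring\<close>

lemma distinct_indices_3 [simp]: "(1::3) \<noteq> 2" "(2::3) \<noteq> 1" "(1::3) \<noteq> 3" "(3::3) \<noteq> 1" "(2::3) \<noteq> 3" "(3::3) \<noteq> 2"
proof -
  have "card (UNIV :: 3 set) = 3" by simp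
  then have "card {1, 2, 3::3} = 3" by (simp only: UNIV_3)
  then show "(1::3) \<noteq> 2" "(2::3) \<noteq> 1" "(1::3) \<noteq> 3" "(3::3) \<noteq> 1" "(2::3) \<noteq> 3" "(3::3) \<noteq> 2"
    by (auto simp: card_insert_if split: if_splits)
qed

context cring
begin

abbreviation H :: "'a \<Rightarrow> 'a \<Rightarrow> 'a \<Rightarrow> 'a^3^3" where "H a b c \<equiv> heisenberg_matrix R a b c"

lemma heisenberg_entries [simp]: "H a b c $ 2 $ 3 = a" "H a b c $ 1 $ 2 = b" "H a b c $ 1 $ 3 = c"
  by (simp_all add: heisenberg_matrix_def)

lemma heisenberg_closed [simp]:
  "a \<in> carrier R \<Longrightarrow> b \<in> carrier R \<Longrightarrow> c \<in> carrier R \<Longrightarrow> H a b c \<in> carrier (heisenberg_group R)"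
  by (auto simp: heisenberg_group_def)

lemma heisenberg_cases:
  assumes "x \<in> carrier (heisenberg_group R)"
  obtains a b c where "a \<in> carrier R" "b \<in> carrier R" "c \<in> carrier R" "x = H a b c"
  using assms by (auto simp: heisenberg_group_def)

lemma heisenberg_one: "\<one>\<^bsub>heisenberg_group R\<^esub> = H \<zero> \<zero> \<zero>"
  by (simp add: heisenberg_group_def)

lemma heisenberg_mult [simp]:
  assumes "a \<in> carrier R" "b \<in> carrier R" "c \<in> carrier R" "a' \<in> carrier R" "b' \<in> carrier R" "c' \<in> carrier R"
  shows "H a b c \<otimes>\<^bsub>heisenberg_group R\<^esub> H a' b' c' = H (a \<oplus> a') (b \<oplus> b') (c \<oplus> c' \<oplus> b \<otimes> a')"
proof -
  have sum3: "(\<Oplus>k\<in>UNIV. g k) = g 1 \<oplus> g 2 \<oplus> g 3" if "g \<in> UNIV \<rightarrow> carrier R" for g :: "3 \<Rightarrow> 'a"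
    using that unfolding UNIV_3 by (subst finsum_insert; (simp add: a_ac Pi_iff)?)+
  have entries: "H a b c $ i $ j \<in> carrier R" "H a' b' c' $ i $ j \<in> carrier R" for i j
    using assms by (simp_all add: heisenberg_matrix_def)
  have "matrix_mult R (H a b c) (H a' b' c') = H (a \<oplus> a') (b \<oplus> b') (c \<oplus> c' \<oplus> b \<otimes> a')"
    using assms
    by (simp add: vec_eq_iff forall_3 matrix_mult_def sum3 entries)
       (simp add: heisenberg_matrix_def a_ac)
  then show ?thesis by (simp add: heisenberg_group_def)
qed

lemma group_heisenberg: "group (heisenberg_group R)"
proof (rule groupI)
  fix x y z
  assume "x \<in> carrier (heisenberg_group R)" "y \<in> carrier (heisenberg_group R)" "z \<in> carrier (heisenberg_group R)"
  then obtain a b c a' b' c' a'' b'' c'' where [simp]: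
    "a \<in> carrier R" "b \<in> carrier R" "c \<in> carrier R" "x = H a b c"
    "a' \<in> carrier R" "b' \<in> carrier R" "c' \<in> carrier R" "y = H a' b' c'"
    "a'' \<in> carrier R" "b'' \<in> carrier R" "c'' \<in> carrier R" "z = H a'' b'' c''"
    by (elim heisenberg_cases)
  show "x \<otimes>\<^bsub>heisenberg_group R\<^esub> y \<in> carrier (heisenberg_group R)" by simp
  show "x \<otimes>\<^bsub>heisenberg_group R\<^esub> y \<otimes>\<^bsub>heisenberg_group R\<^esub> z =
        x \<otimes>\<^bsub>heisenberg_group R\<^esub> (y \<otimes>\<^bsub>heisenberg_group R\<^esub> z)"
    by (simp add: a_ac l_distr r_distr)
next
  fix x assume "x \<in> carrier (heisenberg_group R)"
  then obtain a b c where [simp]: "a \<in> carrier R" "b \<in> carrier R" "c \<in> carrier R" "x = H a b c"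
    by (elim heisenberg_cases)
  show "\<one>\<^bsub>heisenberg_group R\<^esub> \<otimes>\<^bsub>heisenberg_group R\<^esub> x = x"
    by (simp add: heisenberg_one)
  show "\<exists>y\<in>carrier (heisenberg_group R). y \<otimes>\<^bsub>heisenberg_group R\<^esub> x = \<one>\<^bsub>heisenberg_group R\<^esub>"
    by (rule bexI[of _ "H (\<ominus> a) (\<ominus> b) (\<ominus> c \<oplus> b \<otimes> a)"])
       (simp_all add: heisenberg_one l_neg l_minus a_assoc,
        simp add: a_ac l_neg r_neg)
qed (simp add: heisenberg_one)

text \<open>The two expressions that become cocycles after applying a character of \<open>R\<close>.  Without
  the terms in \<open>h = 1/2\<close> the two sides differ by \<open>b a' a''\<close> in the first identity and by \<open>b b' a''\<close> in
  the second, which is the polarization of the quadratic term.\<close>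

lemma heisenberg_cocycle_identity_left:
  assumes cl: "b \<in> carrier R" "c \<in> carrier R" "b' \<in> carrier R" "c' \<in> carrier R"
      "a' \<in> carrier R" "a'' \<in> carrier R" "h \<in> carrier R"
    and h: "\<And>t. t \<in> carrier R \<Longrightarrow> h \<otimes> t \<oplus> h \<otimes> t = t"
  shows "c' \<otimes> a'' \<oplus> h \<otimes> (b' \<otimes> (a'' \<otimes> a'')) \<oplus> (c \<otimes> (a' \<oplus> a'') \<oplus> h \<otimes> (b \<otimes> ((a' \<oplus> a'') \<otimes> (a' \<oplus> a'')))) =
    (c \<oplus> c' \<oplus> b \<otimes> a') \<otimes> a'' \<oplus> h \<otimes> ((b \<oplus> b') \<otimes> (a'' \<otimes> a'')) \<oplus> (c \<otimes> a' \<oplus> h \<otimes> (b \<otimes> (a' \<otimes> a')))"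
proof -
  have "h \<otimes> (b \<otimes> ((a' \<oplus> a'') \<otimes> (a' \<oplus> a''))) =
      h \<otimes> (b \<otimes> (a' \<otimes> a')) \<oplus> h \<otimes> (b \<otimes> (a'' \<otimes> a'')) \<oplus>
      (h \<otimes> (b \<otimes> a' \<otimes> a'') \<oplus> h \<otimes> (b \<otimes> a' \<otimes> a''))"
    using cl by algebra
  then have "h \<otimes> (b \<otimes> ((a' \<oplus> a'') \<otimes> (a' \<oplus> a''))) =
      h \<otimes> (b \<otimes> (a' \<otimes> a')) \<oplus> h \<otimes> (b \<otimes> (a'' \<otimes> a'')) \<oplus> b \<otimes> a' \<otimes> a''"
    using cl h by simp
  then show ?thesis by (simp only:) (insert cl, algebra)
qed

lemma heisenberg_cocycle_identity_right:
  assumes cl: "b \<in> carrier R" "c' \<in> carrier R" "b' \<in> carrier R" "c'' \<in> carrier R"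
      "a' \<in> carrier R" "a'' \<in> carrier R" "h \<in> carrier R"
    and h: "\<And>t. t \<in> carrier R \<Longrightarrow> h \<otimes> t \<oplus> h \<otimes> t = t"
  shows "b' \<otimes> c'' \<oplus> h \<otimes> (b' \<otimes> b' \<otimes> a'') \<oplus> (b \<otimes> (c' \<oplus> c'' \<oplus> b' \<otimes> a'') \<oplus> h \<otimes> (b \<otimes> b \<otimes> (a' \<oplus> a''))) =
    (b \<oplus> b') \<otimes> c'' \<oplus> h \<otimes> ((b \<oplus> b') \<otimes> (b \<oplus> b') \<otimes> a'') \<oplus> (b \<otimes> c' \<oplus> h \<otimes> (b \<otimes> b \<otimes> a'))"
proof -
  have "h \<otimes> ((b \<oplus> b') \<otimes> (b \<oplus> b') \<otimes> a'') =
      h \<otimes> (b \<otimes> b \<otimes> a'') \<oplus> h \<otimes> (b' \<otimes> b' \<otimes> a'') \<oplus>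
      (h \<otimes> (b \<otimes> b' \<otimes> a'') \<oplus> h \<otimes> (b \<otimes> b' \<otimes> a''))"
    using cl by algebra
  then have "h \<otimes> ((b \<oplus> b') \<otimes> (b \<oplus> b') \<otimes> a'') =
      h \<otimes> (b \<otimes> b \<otimes> a'') \<oplus> h \<otimes> (b' \<otimes> b' \<otimes> a'') \<oplus> b \<otimes> b' \<otimes> a''"
    using cl h by simp
  then show ?thesis by (simp only:) (insert cl, algebra)
qed

end

section \<open>An explicit family of cocycles\<close>

text \<open>That the unit is a basis element is what makes the bicharacters with \<open>\<kappa>(1, \<cdot>) = 1\<close> a direct factor
  of all bicharacters, with parameters indexed by the rows \<open>i > 0\<close>.\<close>

locale heisenberg_basis = cring R for R (structure) +
  fixes n r :: nat and e :: "nat \<Rightarrow> 'a" and \<pi> :: "nat \<Rightarrow> 'a \<Rightarrow> nat"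
  assumes odd_n: "odd n"
    and basis: "zn_basis (add_monoid R) n r e \<pi>"
    and r_pos: "0 < r" and e_0: "e 0 = \<one>"
    and coord_basis: "i < r \<Longrightarrow> j < r \<Longrightarrow> [\<pi> i (e j) = (if i = j then 1 else 0)] (mod n)"

sublocale heisenberg_basis \<subseteq> A: zn_basis "add_monoid R" n r e \<pi>
  rewrites "carrier (add_monoid R) = carrier R"
    and "monoid.mult (add_monoid R) = (\<oplus>\<^bsub>R\<^esub>)"
    and "monoid.one (add_monoid R) = \<zero>\<^bsub>R\<^esub>"
  by (simp_all add: basis)

context heisenberg_basis
begin

abbreviation G where "G \<equiv> heisenberg_group R"

definition linear_char :: "(nat \<Rightarrow> int) \<Rightarrow> 'a \<Rightarrow> complex" where
  "linear_char u a = unity_root n (\<Sum>i<r. u i * int (\<pi> i a))"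

definition bilinear_char :: "(nat \<Rightarrow> nat \<Rightarrow> int) \<Rightarrow> 'a \<Rightarrow> 'a \<Rightarrow> complex" where
  "bilinear_char u a b = unity_root n (\<Sum>i<r. \<Sum>j<r. u i j * int (\<pi> i a) * int (\<pi> j b))"

lemma character_linear_char: "A.character (linear_char u)"
  using A.character_unity_root[of u] by (simp add: linear_char_def[abs_def])

lemma bicharacter_bilinear_char: "A.bicharacter (bilinear_char u)"
  using A.bicharacter_unity_root[of u] by (simp add: bilinear_char_def[abs_def])

lemma linear_char_add: "a \<in> carrier R \<Longrightarrow> b \<in> carrier R \<Longrightarrow> linear_char u (a \<oplus> b) = linear_char u a * linear_char u b"
  using character_linear_char[of u] by (simp add: A.character_def)

lemma linear_char_zero [simp]: "linear_char u \<zero> = 1"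
  by (rule A.character_one[OF character_linear_char])

lemma linear_char_nonzero [simp]: "linear_char u a \<noteq> 0" and bilinear_char_nonzero [simp]: "bilinear_char w a b \<noteq> 0"
  by (simp_all add: linear_char_def bilinear_char_def)

lemma bilinear_char_add:
  assumes "a \<in> carrier R" "b \<in> carrier R" "c \<in> carrier R"
  shows "bilinear_char u (a \<oplus> b) c = bilinear_char u a c * bilinear_char u b c" "bilinear_char u c (a \<oplus> b) = bilinear_char u c a * bilinear_char u c b"
  using bicharacter_bilinear_char[of u] assms by (simp_all add: A.bicharacter_def A.character_def)

lemma bilinear_char_zero [simp]:
  assumes "a \<in> carrier R" shows "bilinear_char u \<zero> a = 1" "bilinear_char u a \<zero> = 1"
  using bicharacter_bilinear_char[of u] assms A.character_one[of "bilinear_char u a"] A.character_one[of "\<lambda>b. bilinear_char u b a"]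
  by (simp_all add: A.bicharacter_def)

lemma linear_char_basis: assumes "j < r" shows "linear_char u (e j) = unity_root n (u j)"
proof -
  have "[(\<Sum>i<r. u i * int (\<pi> i (e j))) = (\<Sum>i<r. u i * int (if i = j then 1 else 0))] (mod int n)"
    using coord_basis[OF _ assms] by (intro cong_sum cong_mult cong_refl) (auto simp only: cong_int_iff lessThan_iff)
  also have "(\<Sum>i<r. u i * int (if i = j then 1 else 0)) = (\<Sum>i<r. if i = j then u i else 0)"
    by (rule sum.cong) auto
  also have "\<dots> = u j" using assms by (simp add: sum.delta)
  finally show ?thesis unfolding linear_char_def by (rule unity_root_cong[OF A.n_pos])
qed

lemma bilinear_char_basis: assumes "i < r" "j < r" shows "bilinear_char u (e i) (e j) = unity_root n (u i j)"
proof -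
  have "bilinear_char u (e i) (e j) = linear_char (\<lambda>i. \<Sum>j'<r. u i j' * int (\<pi> j' (e j))) (e i)"
    by (simp add: bilinear_char_def linear_char_def sum_distrib_left sum_distrib_right mult_ac)
  also have "\<dots> = linear_char (u i) (e j)"
    unfolding linear_char_basis[OF assms(1)] by (simp only: linear_char_def)
  finally show ?thesis using assms by (simp add: linear_char_basis)
qed

definition half :: 'a where "half = add_pow R ((n + 1) div 2) \<one>"

lemma half_closed [simp]: "half \<in> carrier R"
  by (simp add: half_def)

lemma half_plus_half:
  assumes "t \<in> carrier R" shows "half \<otimes> t \<oplus> half \<otimes> t = t"
proof -
  have "add_pow R n \<one> = \<zero>" using A.e_pow_n[OF r_pos] by (simp add: e_0 add_pow_def)
  moreover have "(n + 1) div 2 + (n + 1) div 2 = n + 1" using odd_n by (auto elim: oddE)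
  then have "half \<oplus> half = add_pow R (n + 1) \<one>"
    unfolding half_def by (simp only: add.nat_pow_mult one_closed)
  moreover have "add_pow R (n + 1) \<one> = add_pow R n \<one> \<oplus> \<one>"
    by (simp add: add.nat_pow_Suc)
  ultimately have "half \<oplus> half = \<one>" by simp
  then show ?thesis using assms by (simp flip: l_distr)
qed

text \<open>With \<open>a\<close>, \<open>b\<close>, \<open>c\<close> the entries of \<open>x\<close> and \<open>a'\<close>, \<open>b'\<close>, \<open>c'\<close> those of \<open>y\<close>, the next two are
  \<open>c a' + b a'\<^sup>2/2\<close> and \<open>b c' + b\<^sup>2 a'/2\<close>.\<close>

definition left_form :: "'a^3^3 \<Rightarrow> 'a^3^3 \<Rightarrow> 'a" where
  "left_form x y = x $ 1 $ 3 \<otimes> y $ 2 $ 3 \<oplus> half \<otimes> (x $ 1 $ 2 \<otimes> (y $ 2 $ 3 \<otimes> y $ 2 $ 3))"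

definition right_form :: "'a^3^3 \<Rightarrow> 'a^3^3 \<Rightarrow> 'a" where
  "right_form x y = x $ 1 $ 2 \<otimes> y $ 1 $ 3 \<oplus> half \<otimes> (x $ 1 $ 2 \<otimes> x $ 1 $ 2 \<otimes> y $ 2 $ 3)"

text \<open>The \<open>2r\<^sup>2\<close> parameters are stored in two \<open>r \<times> r\<close> matrices.  In the matrix \<open>False\<close>, the diagonal is
  the character on \<open>left_form\<close>, and the parts above and below it are the alternating forms among
  the \<open>x\<^sub>a\<close> and among the \<open>y\<^sub>b\<close>.  In the matrix \<open>True\<close>, row 0 is the character on \<open>right_form\<close> and the
  other rows are a bicharacter \<open>\<kappa>\<close> with \<open>\<kappa>(1, \<cdot>) = 1\<close>.\<close>

definition heis_cocycle :: "(bool \<times> nat \<times> nat \<Rightarrow> int) \<Rightarrow> 'a^3^3 \<Rightarrow> 'a^3^3 \<Rightarrow> complex" where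
  "heis_cocycle v x y =
     linear_char (\<lambda>i. v (False, i, i)) (left_form x y) *
     linear_char (\<lambda>j. v (True, 0, j)) (right_form x y) *
     bilinear_char (\<lambda>i j. if i < j then v (False, i, j) else 0) (x $ 2 $ 3) (y $ 2 $ 3) *
     bilinear_char (\<lambda>i j. if j < i then v (False, i, j) else 0) (x $ 1 $ 2) (y $ 1 $ 2) *
     bilinear_char (\<lambda>i j. if i = 0 then 0 else v (True, i, j)) (x $ 1 $ 2) (y $ 2 $ 3)"

lemma left_form_cocycle:
  assumes "x \<in> carrier G" "y \<in> carrier G" "z \<in> carrier G"
  shows "left_form y z \<oplus> left_form x (y \<otimes>\<^bsub>G\<^esub> z) = left_form (x \<otimes>\<^bsub>G\<^esub> y) z \<oplus> left_form x y"
  using assms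
  by (elim heisenberg_cases) (simp add: left_form_def heisenberg_cocycle_identity_left[OF _ _ _ _ _ _ half_closed half_plus_half])

lemma right_form_cocycle:
  assumes "x \<in> carrier G" "y \<in> carrier G" "z \<in> carrier G"
  shows "right_form y z \<oplus> right_form x (y \<otimes>\<^bsub>G\<^esub> z) = right_form (x \<otimes>\<^bsub>G\<^esub> y) z \<oplus> right_form x y"
  using assms
  by (elim heisenberg_cases) (simp add: right_form_def heisenberg_cocycle_identity_right[OF _ _ _ _ _ _ half_closed half_plus_half])

lemma left_form_closed [simp]: "x \<in> carrier G \<Longrightarrow> y \<in> carrier G \<Longrightarrow> left_form x y \<in> carrier R"
  and right_form_closed [simp]: "x \<in> carrier G \<Longrightarrow> y \<in> carrier G \<Longrightarrow> right_form x y \<in> carrier R"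
  by (elim heisenberg_cases, simp add: left_form_def right_form_def)+

lemma heisenberg_mult_closed:
  "x \<in> carrier G \<Longrightarrow> y \<in> carrier G \<Longrightarrow> x \<otimes>\<^bsub>G\<^esub> y \<in> carrier G"
  by (elim heisenberg_cases) simp

lemma linear_char_cocycle:
  assumes "\<And>x y. x \<in> carrier G \<Longrightarrow> y \<in> carrier G \<Longrightarrow> q x y \<in> carrier R"
    and "\<And>x y z. x \<in> carrier G \<Longrightarrow> y \<in> carrier G \<Longrightarrow> z \<in> carrier G \<Longrightarrow>
           q y z \<oplus> q x (y \<otimes>\<^bsub>G\<^esub> z) = q (x \<otimes>\<^bsub>G\<^esub> y) z \<oplus> q x y"
  shows "is_cocycle G (\<lambda>x y. linear_char u (q x y))"
proof (rule is_cocycleI)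
  fix x y z assume "x \<in> carrier G" "y \<in> carrier G" "z \<in> carrier G"
  then show "linear_char u (q y z) * linear_char u (q x (y \<otimes>\<^bsub>G\<^esub> z)) = linear_char u (q (x \<otimes>\<^bsub>G\<^esub> y) z) * linear_char u (q x y)"
    by (simp flip: linear_char_add add: assms heisenberg_mult_closed)
qed simp

lemma bilinear_char_cocycle:
  assumes "A.bicharacter \<beta>"
    and "\<And>x. x \<in> carrier G \<Longrightarrow> q x \<in> carrier R" "\<And>x y. x \<in> carrier G \<Longrightarrow> y \<in> carrier G \<Longrightarrow> q (x \<otimes>\<^bsub>G\<^esub> y) = q x \<oplus> q y"
    and "\<And>x. x \<in> carrier G \<Longrightarrow> s x \<in> carrier R" "\<And>x y. x \<in> carrier G \<Longrightarrow> y \<in> carrier G \<Longrightarrow> s (x \<otimes>\<^bsub>G\<^esub> y) = s x \<oplus> s y"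
  shows "is_cocycle G (\<lambda>x y. \<beta> (q x) (s y))"
  using assms by (intro is_cocycleI) (simp_all add: A.bicharacter_def A.character_def mult_ac)

lemma entry_hom:
  assumes "x \<in> carrier G" "y \<in> carrier G"
  shows "x $ 2 $ 3 \<in> carrier R" "x $ 1 $ 2 \<in> carrier R"
    "(x \<otimes>\<^bsub>G\<^esub> y) $ 2 $ 3 = x $ 2 $ 3 \<oplus> y $ 2 $ 3" "(x \<otimes>\<^bsub>G\<^esub> y) $ 1 $ 2 = x $ 1 $ 2 \<oplus> y $ 1 $ 2"
  by (insert assms, (elim heisenberg_cases, simp)+)

lemma is_cocycle_heis_cocycle: "is_cocycle G (heis_cocycle v)"
proof -
  have b: "is_cocycle G (\<lambda>x y. bilinear_char u (x $ i $ j) (y $ k $ l))"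
    if "(i, j) = (2, 3) \<or> (i, j) = (1, 2)" "(k, l) = (2, 3) \<or> (k, l) = (1, 2)" for u i j k l
    by (rule bilinear_char_cocycle[OF bicharacter_bilinear_char]) (use that entry_hom in auto)
  have l: "is_cocycle G (\<lambda>x y. linear_char u (left_form x y))" "is_cocycle G (\<lambda>x y. linear_char u (right_form x y))" for u
    by (rule linear_char_cocycle; simp add: left_form_cocycle right_form_cocycle)+
  show ?thesis
    unfolding heis_cocycle_def[abs_def] by (intro is_cocycle_mult l b) auto
qed

lemma heis_cocycle_add: "heis_cocycle (\<lambda>i. v i + w i) x y = heis_cocycle v x y * heis_cocycle w x y"
proof -
  have l: "linear_char (\<lambda>i. u i + u' i) a = linear_char u a * linear_char u' a" for u u' a
    by (simp add: linear_char_def unity_root_add[symmetric] sum.distrib distrib_right)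
  have b: "bilinear_char (\<lambda>i j. u i j + u' i j) a b = bilinear_char u a b * bilinear_char u' a b" for u u' a b
    by (simp add: bilinear_char_def unity_root_add[symmetric] sum.distrib distrib_right)
  have i: "(if P then p + q else 0) = (if P then p else 0) + (if P then q else (0::int))"
    "(if P then 0 else p + q) = (if P then 0 else p) + (if P then 0 else (q::int))" for P p q
    by auto
  show ?thesis unfolding heis_cocycle_def i l b by (simp add: mult_ac)
qed

lemma heis_cocycle_periodic:
  assumes "\<forall>i\<in>UNIV \<times> {..<r} \<times> {..<r}. v i mod int n = w i mod int n"
  shows "heis_cocycle v x y = heis_cocycle w x y"
proof -
  have l: "linear_char u a = linear_char u' a" if "\<And>i. i < r \<Longrightarrow> [u i = u' i] (mod int n)" for u u' a
    unfolding linear_char_def using that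
    by (intro unity_root_cong[OF A.n_pos] cong_sum cong_mult cong_refl) auto
  have b: "bilinear_char u a b = bilinear_char u' a b" if "\<And>i j. i < r \<Longrightarrow> j < r \<Longrightarrow> [u i j = u' i j] (mod int n)" for u u' a b
    unfolding bilinear_char_def using that
    by (intro unity_root_cong[OF A.n_pos] cong_sum cong_mult cong_refl) auto
  have vw: "[v (s, i, j) = w (s, i, j)] (mod int n)" if "i < r" "j < r" for s i j
    using assms that by (auto simp: cong_def)
  show ?thesis unfolding heis_cocycle_def
    by (intro arg_cong2[where f="(*)"] l b) (auto simp: vw r_pos)
qed

end

section \<open>Independence modulo coboundaries\<close>

context heisenberg_basis
begin

abbreviation xel where "xel a \<equiv> H a \<zero> \<zero>"
abbreviation yel where "yel b \<equiv> H \<zero> b \<zero>"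
abbreviation zel where "zel c \<equiv> H \<zero> \<zero> c"

text \<open>Each pairing isolates one of the parameter groups; only \<open>\<kappa>\<close> is invisible, since \<open>y\<^sub>b\<close> and \<open>x\<^sub>a\<close> do
  not commute.\<close>

lemma pairing_heis_cocycle:
  assumes "a \<in> carrier R" "b \<in> carrier R"
  shows "comm_pairing (heis_cocycle v) (zel a) (xel b) = linear_char (\<lambda>i. v (False, i, i)) (a \<otimes> b)"
    and "comm_pairing (heis_cocycle v) (yel a) (zel b) = linear_char (\<lambda>j. v (True, 0, j)) (a \<otimes> b)"
    and "comm_pairing (heis_cocycle v) (xel a) (xel b) =
           bilinear_char (\<lambda>i j. if i < j then v (False, i, j) else 0) a b /
           bilinear_char (\<lambda>i j. if i < j then v (False, i, j) else 0) b a"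
    and "comm_pairing (heis_cocycle v) (yel a) (yel b) =
           bilinear_char (\<lambda>i j. if j < i then v (False, i, j) else 0) a b /
           bilinear_char (\<lambda>i j. if j < i then v (False, i, j) else 0) b a"
  using assms by (simp_all add: comm_pairing_def heis_cocycle_def left_form_def right_form_def)

lemma unity_root_linear_char_basis_trivial:
  assumes "\<And>a. a \<in> carrier R \<Longrightarrow> linear_char u a = 1" "i < r"
  shows "int n dvd u i"
  using assms(1)[of "e i"] assms(2) by (simp add: linear_char_basis unity_root_eq_1_iff[OF A.n_pos])

text \<open>The pairings of a coboundary are trivial, which kills every parameter except \<open>\<kappa>\<close>.  Comparing
  \<open>y\<^sub>b x\<^sub>a\<close> with \<open>x\<^sub>a y\<^sub>b z\<^sub>b\<^sub>a\<close> then shows that \<open>\<kappa>(b, a)\<close> depends on \<open>ba\<close> alone, so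
  \<open>\<kappa>(b, a) = \<kappa>(1, ba) = 1\<close>.\<close>

lemma heis_cocycle_coboundary_trivial:
  assumes cob: "is_coboundary G (heis_cocycle v)" and I: "k \<in> UNIV \<times> {..<r} \<times> {..<r}"
  shows "int n dvd v k"
proof -
  have pair1: "comm_pairing (heis_cocycle v) x y = 1"
    if "x \<in> carrier G" "y \<in> carrier G" "x \<otimes>\<^bsub>G\<^esub> y = y \<otimes>\<^bsub>G\<^esub> x" for x y
    using comm_pairing_coboundary[OF cob that] heisenberg_mult_closed that by blast
  have l: "linear_char (\<lambda>i. v (False, i, i)) c = 1" if "c \<in> carrier R" for c
    using pair1[of "zel c" "xel \<one>"] pairing_heis_cocycle(1)[of c \<one> v] that by simp
  have m: "linear_char (\<lambda>j. v (True, 0, j)) c = 1" if "c \<in> carrier R" for c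
    using pair1[of "yel \<one>" "zel c"] pairing_heis_cocycle(2)[of \<one> c v] that by simp
  have s: "int n dvd v (False, i, j)" if "i < j" "j < r" for i j
    using pair1[of "xel (e i)" "xel (e j)"] pairing_heis_cocycle(3)[of "e i" "e j" v] that
    by (simp add: bilinear_char_basis a_comm unity_root_eq_1_iff[OF A.n_pos])
  have t: "int n dvd v (False, i, j)" if "j < i" "i < r" for i j
    using pair1[of "yel (e i)" "yel (e j)"] pairing_heis_cocycle(4)[of "e i" "e j" v] that
    by (simp add: bilinear_char_basis a_comm unity_root_eq_1_iff[OF A.n_pos])
  define \<kappa> where "\<kappa> = bilinear_char (\<lambda>i j. if i = 0 then 0 else v (True, i, j))"
  obtain \<phi> where nz: "\<And>x. x \<in> carrier G \<Longrightarrow> \<phi> x \<noteq> 0"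
    and \<phi>: "\<And>x y. x \<in> carrier G \<Longrightarrow> y \<in> carrier G \<Longrightarrow> heis_cocycle v x y = \<phi> x * \<phi> y / \<phi> (x \<otimes>\<^bsub>G\<^esub> y)"
    using cob unfolding is_coboundary_def by blast
  have \<kappa>: "\<kappa> b a = 1 / \<phi> (zel (b \<otimes> a))" if "a \<in> carrier R" "b \<in> carrier R" for a b
  proof -
    have "heis_cocycle v (yel b) (xel a) = \<kappa> b a" "heis_cocycle v (xel a) (yel b) = 1" "heis_cocycle v (H a b \<zero>) (zel (b \<otimes> a)) = 1"
      using that by (simp_all add: heis_cocycle_def left_form_def right_form_def \<kappa>_def l m)
    then have "\<kappa> b a = \<phi> (yel b) * \<phi> (xel a) / \<phi> (H a b (b \<otimes> a))"
      and "1 = \<phi> (xel a) * \<phi> (yel b) / \<phi> (H a b \<zero>)"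
      and "1 = \<phi> (H a b \<zero>) * \<phi> (zel (b \<otimes> a)) / \<phi> (H a b (b \<otimes> a))"
      using \<phi>[of "yel b" "xel a"] \<phi>[of "xel a" "yel b"] \<phi>[of "H a b \<zero>" "zel (b \<otimes> a)"] that
      by simp_all
    moreover have "\<phi> (H a b \<zero>) \<noteq> 0" "\<phi> (zel (b \<otimes> a)) \<noteq> 0" "\<phi> (H a b (b \<otimes> a)) \<noteq> 0"
      using nz that by simp_all
    ultimately show ?thesis by (auto simp: divide_simps mult_ac)
  qed
  have one: "\<kappa> \<one> c = 1" if "c \<in> carrier R" for c
  proof -
    have "A.character (\<kappa> \<one>)" "A.character (\<lambda>_. 1)"
      using bicharacter_bilinear_char by (simp_all add: \<kappa>_def A.bicharacter_def A.character_def)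
    then show ?thesis
    proof (rule A.character_eqI[OF _ _ _ that])
      show "\<kappa> \<one> (e j) = 1" if "j < r" for j
        using that by (simp add: \<kappa>_def bilinear_char_basis r_pos flip: e_0)
    qed
  qed
  have k: "int n dvd v (True, i, j)" if "0 < i" "i < r" "j < r" for i j
  proof -
    have "\<kappa> (e i) (e j) = \<kappa> \<one> (e i \<otimes> e j)" using that by (simp add: \<kappa>)
    then show ?thesis using that
      by (simp add: one) (simp add: \<kappa>_def bilinear_char_basis unity_root_eq_1_iff[OF A.n_pos])
  qed
  from I obtain q i j where kij: "k = (q, i, j)" "i < r" "j < r" by auto
  show ?thesis
  proof (cases q)
    case True
    then show ?thesis
      using kij k unity_root_linear_char_basis_trivial[of "\<lambda>j. v (True, 0, j)" j] m by (cases "i = 0") auto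
  next
    case False
    then show ?thesis
      using kij s t unity_root_linear_char_basis_trivial[of "\<lambda>i. v (False, i, i)" i] l
      by (cases i j rule: linorder_cases) auto
  qed
qed

section \<open>Every cocycle is equivalent to a member of the family\<close>

text \<open>\<open>P\<close> picks one of each two opposite index pairs, and the basis values there determine an
  alternating bicharacter.  It is used with \<open>i < j\<close> for the \<open>x\<^sub>a\<close> and with \<open>j < i\<close> for the \<open>y\<^sub>b\<close>, as the
  two share one parameter matrix.\<close>

lemma half_of_alternating_bicharacter:
  assumes \<beta>: "A.bicharacter \<beta>" and alt: "\<And>a. a \<in> carrier R \<Longrightarrow> \<beta> a a = 1"
    and P: "\<And>i j. i \<noteq> j \<Longrightarrow> P i j \<longleftrightarrow> \<not> P j i" "\<And>i. \<not> P i i"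
  shows "\<exists>u. \<forall>a\<in>carrier R. \<forall>b\<in>carrier R.
           \<beta> a b = bilinear_char (\<lambda>i j. if P i j then u i j else 0) a b / bilinear_char (\<lambda>i j. if P i j then u i j else 0) b a"
proof -
  obtain u where u: "\<And>i j. i < r \<Longrightarrow> j < r \<Longrightarrow> \<beta> (e i) (e j) = unity_root n (u i j)"
    using A.bicharacter_basis_values[OF \<beta>] by blast
  define s where "s = (\<lambda>i j. if P i j then u i j else 0)"
  have skew: "\<beta> a b * \<beta> b a = 1" if "a \<in> carrier R" "b \<in> carrier R" for a b
  proof -
    have "\<beta> (a \<oplus> b) (a \<oplus> b) = \<beta> a a * \<beta> a b * (\<beta> b a * \<beta> b b)"
      using \<beta> that by (simp add: A.bicharacter_def A.character_def)
    with alt that show ?thesis by simp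
  qed
  have "\<beta> a b = bilinear_char s a b / bilinear_char s b a" if "a \<in> carrier R" "b \<in> carrier R" for a b
  proof (rule A.bicharacter_eqI[OF \<beta> _ _ that, of "\<lambda>a b. bilinear_char s a b / bilinear_char s b a"])
    show "A.bicharacter (\<lambda>a b. bilinear_char s a b / bilinear_char s b a)"
      by (rule A.bicharacter_divide[OF bicharacter_bilinear_char A.bicharacter_flip[OF bicharacter_bilinear_char]])
    fix i j assume ij: "i < r" "j < r"
    show "\<beta> (e i) (e j) = bilinear_char s (e i) (e j) / bilinear_char s (e j) (e i)"
      using ij u[OF ij] u[OF ij(2,1)] skew[of "e i" "e j"] alt[of "e i"] P(1)[of i j] P(2)[of i]
      by (cases "i = j"; cases "P i j") (auto simp: bilinear_char_basis s_def field_simps)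
  qed
  then show ?thesis unfolding s_def by blast
qed

lemma pairing_central_bicharacters:
  assumes f: "is_cocycle G f"
  shows "A.bicharacter (\<lambda>c a. comm_pairing f (zel c) (xel a))"
    and "A.bicharacter (\<lambda>b c. comm_pairing f (yel b) (zel c))"
    and "A.bicharacter (\<lambda>a a'. comm_pairing f (xel a) (xel a'))"
    and "A.bicharacter (\<lambda>b b'. comm_pairing f (yel b) (yel b'))"
proof -
  interpret G: group G by (rule group_heisenberg)
  have add: "xel (a \<oplus> a') = xel a \<otimes>\<^bsub>G\<^esub> xel a'" "yel (a \<oplus> a') = yel a \<otimes>\<^bsub>G\<^esub> yel a'"
    "zel (a \<oplus> a') = zel a \<otimes>\<^bsub>G\<^esub> zel a'"
    if "a \<in> carrier R" "a' \<in> carrier R" for a a'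
    using that by simp_all
  note mult = G.comm_pairing_mult_left[OF f] G.comm_pairing_mult_right[OF f]
  show "A.bicharacter (\<lambda>c a. comm_pairing f (zel c) (xel a))"
    by (rule A.bicharacterI; (simp only: add)?; (rule comm_pairing_nonzero[OF f] mult)?; simp add: a_comm)
  show "A.bicharacter (\<lambda>b c. comm_pairing f (yel b) (zel c))"
    by (rule A.bicharacterI; (simp only: add)?; (rule comm_pairing_nonzero[OF f] mult)?; simp add: a_comm)
  show "A.bicharacter (\<lambda>a a'. comm_pairing f (xel a) (xel a'))"
    by (rule A.bicharacterI; (simp only: add)?; (rule comm_pairing_nonzero[OF f] mult)?; simp add: a_comm)
  show "A.bicharacter (\<lambda>b b'. comm_pairing f (yel b) (yel b'))"
    by (rule A.bicharacterI; (simp only: add)?; (rule comm_pairing_nonzero[OF f] mult)?; simp add: a_comm)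
qed

text \<open>A homomorphism from the Heisenberg group to \<open>\<complex>\<^sup>\<times>\<close>, such as the pairing with a central element,
  is trivial on the centre because \<open>z\<^sub>c\<close> is the commutator of \<open>y\<^sub>1\<close> and \<open>x\<^sub>c\<close>.\<close>

lemma pairing_center_generic:
  assumes f: "is_cocycle G f" and c: "a \<in> carrier R" "b \<in> carrier R" "c \<in> carrier R" "d \<in> carrier R"
  shows "comm_pairing f (zel d) (H a b c) =
     comm_pairing f (zel d) (xel a) * comm_pairing f (zel d) (yel b)"
    and "comm_pairing f (zel d) (zel c) = 1"
proof -
  interpret G: group G by (rule group_heisenberg)
  have mult: "comm_pairing f (zel d) (x \<otimes>\<^bsub>G\<^esub> y) = comm_pairing f (zel d) x * comm_pairing f (zel d) y"
    if "x \<in> carrier G" "y \<in> carrier G" for x y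
    using that c by (intro G.comm_pairing_mult_right[OF f]) (auto elim!: heisenberg_cases simp: a_comm)
  have zz: "comm_pairing f (zel d) (zel c) = 1" if c: "c \<in> carrier R" for c
  proof -
    have "yel \<one> \<otimes>\<^bsub>G\<^esub> xel c = xel c \<otimes>\<^bsub>G\<^esub> yel \<one> \<otimes>\<^bsub>G\<^esub> zel c"
      using c by simp
    then have "comm_pairing f (zel d) (yel \<one> \<otimes>\<^bsub>G\<^esub> xel c) =
        comm_pairing f (zel d) (xel c \<otimes>\<^bsub>G\<^esub> yel \<one> \<otimes>\<^bsub>G\<^esub> zel c)" by simp
    then have "comm_pairing f (zel d) (yel \<one>) * comm_pairing f (zel d) (xel c) =
        comm_pairing f (zel d) (xel c) * comm_pairing f (zel d) (yel \<one>) * comm_pairing f (zel d) (zel c)"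
      using c by (simp only: mult heisenberg_closed zero_closed one_closed G.m_closed)
    then show ?thesis
      using comm_pairing_nonzero[OF f, of "zel d"] c \<open>d \<in> carrier R\<close> by simp
  qed
  then show "comm_pairing f (zel d) (zel c) = 1" using c by simp
  have "H a b c = xel a \<otimes>\<^bsub>G\<^esub> yel b \<otimes>\<^bsub>G\<^esub> zel c" using c by simp
  then show "comm_pairing f (zel d) (H a b c) =
     comm_pairing f (zel d) (xel a) * comm_pairing f (zel d) (yel b)"
    using c zz by (simp only: mult heisenberg_closed zero_closed G.m_closed mult_1_right)
qed

text \<open>Conjugation by \<open>y\<^sub>c\<close> turns the commuting pair \<open>x\<^sub>1\<close>, \<open>x\<^sub>a\<close> into \<open>x\<^sub>1 z\<^sub>c\<close>, \<open>x\<^sub>a z\<^sub>c\<^sub>a\<close>.  The pairing does not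
  change, so the two mixed terms that arise by expanding it cancel.\<close>

lemma pairing_zx_balanced:
  assumes f: "is_cocycle G f" and c: "a \<in> carrier R" "c \<in> carrier R"
  shows "comm_pairing f (zel c) (xel a) = comm_pairing f (zel (c \<otimes> a)) (xel \<one>)"
proof -
  interpret G: group G by (rule group_heisenberg)
  let ?p = "comm_pairing f"
  have conj: "?p (xel \<one> \<otimes>\<^bsub>G\<^esub> zel c) (xel a \<otimes>\<^bsub>G\<^esub> zel (c \<otimes> a)) = ?p (xel \<one>) (xel a)"
    using c by (intro G.comm_pairing_conj[OF f, of _ _ _ _ "yel c"]) (simp_all add: a_comm)
  have "?p (xel \<one> \<otimes>\<^bsub>G\<^esub> zel c) (xel a \<otimes>\<^bsub>G\<^esub> zel (c \<otimes> a)) =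
        (?p (xel \<one>) (xel a) * ?p (xel \<one>) (zel (c \<otimes> a))) * (?p (zel c) (xel a) * ?p (zel c) (zel (c \<otimes> a)))"
  proof -
    have "?p (xel \<one> \<otimes>\<^bsub>G\<^esub> zel c) (xel a \<otimes>\<^bsub>G\<^esub> zel (c \<otimes> a)) =
        ?p (xel \<one>) (xel a \<otimes>\<^bsub>G\<^esub> zel (c \<otimes> a)) * ?p (zel c) (xel a \<otimes>\<^bsub>G\<^esub> zel (c \<otimes> a))"
      by (rule G.comm_pairing_mult_left[OF f]) (use c in \<open>simp_all add: a_comm\<close>)
    moreover have "?p (xel \<one>) (xel a \<otimes>\<^bsub>G\<^esub> zel (c \<otimes> a)) = ?p (xel \<one>) (xel a) * ?p (xel \<one>) (zel (c \<otimes> a))"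
      by (rule G.comm_pairing_mult_right[OF f]) (use c in \<open>simp_all add: a_comm\<close>)
    moreover have "?p (zel c) (xel a \<otimes>\<^bsub>G\<^esub> zel (c \<otimes> a)) = ?p (zel c) (xel a) * ?p (zel c) (zel (c \<otimes> a))"
      by (rule G.comm_pairing_mult_right[OF f]) (use c in \<open>simp_all add: a_comm\<close>)
    ultimately show ?thesis by (simp only:)
  qed
  with conj have "?p (xel \<one>) (zel (c \<otimes> a)) * ?p (zel c) (xel a) = 1"
    using comm_pairing_nonzero[OF f, of "xel \<one>" "xel a"] pairing_center_generic(2)[OF f] c by simp
  then show ?thesis
    using comm_pairing_commute[of f "xel \<one>" "zel (c \<otimes> a)"] comm_pairing_nonzero[OF f, of "xel \<one>" "zel (c \<otimes> a)"] c
    by (simp add: field_simps)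
qed

text \<open>The mirror image, with the commuting pair \<open>y\<^sub>b\<close>, \<open>y\<^sub>1\<close>.  The conjugating element is \<open>x\<^sub>a\<close> with \<open>a = - c\<close>,
  whose conjugation multiplies \<open>y\<^sub>b\<close> by \<open>z\<^sub>b\<^sub>c\<close> without a sign.\<close>

lemma pairing_yz_balanced:
  assumes f: "is_cocycle G f" and c: "b \<in> carrier R" "c \<in> carrier R"
  shows "comm_pairing f (yel b) (zel c) = comm_pairing f (yel \<one>) (zel (b \<otimes> c))"
proof -
  interpret G: group G by (rule group_heisenberg)
  let ?p = "comm_pairing f"
  have conj: "?p (yel b \<otimes>\<^bsub>G\<^esub> zel (b \<otimes> c)) (yel \<one> \<otimes>\<^bsub>G\<^esub> zel c) = ?p (yel b) (yel \<one>)"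
    using c by (intro G.comm_pairing_conj[OF f, of _ _ _ _ "xel (\<ominus> c)"]) (simp_all add: a_comm r_minus r_neg)
  have "?p (yel b \<otimes>\<^bsub>G\<^esub> zel (b \<otimes> c)) (yel \<one> \<otimes>\<^bsub>G\<^esub> zel c) =
        (?p (yel b) (yel \<one>) * ?p (yel b) (zel c)) * (?p (zel (b \<otimes> c)) (yel \<one>) * ?p (zel (b \<otimes> c)) (zel c))"
  proof -
    have "?p (yel b \<otimes>\<^bsub>G\<^esub> zel (b \<otimes> c)) (yel \<one> \<otimes>\<^bsub>G\<^esub> zel c) =
        ?p (yel b) (yel \<one> \<otimes>\<^bsub>G\<^esub> zel c) * ?p (zel (b \<otimes> c)) (yel \<one> \<otimes>\<^bsub>G\<^esub> zel c)"
      by (rule G.comm_pairing_mult_left[OF f]) (use c in \<open>simp_all add: a_comm\<close>)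
    moreover have "?p (yel b) (yel \<one> \<otimes>\<^bsub>G\<^esub> zel c) = ?p (yel b) (yel \<one>) * ?p (yel b) (zel c)"
      by (rule G.comm_pairing_mult_right[OF f]) (use c in \<open>simp_all add: a_comm\<close>)
    moreover have "?p (zel (b \<otimes> c)) (yel \<one> \<otimes>\<^bsub>G\<^esub> zel c) = ?p (zel (b \<otimes> c)) (yel \<one>) * ?p (zel (b \<otimes> c)) (zel c)"
      by (rule G.comm_pairing_mult_right[OF f]) (use c in \<open>simp_all add: a_comm\<close>)
    ultimately show ?thesis by (simp only:)
  qed
  with conj have "?p (yel b) (zel c) * ?p (zel (b \<otimes> c)) (yel \<one>) = 1"
    using comm_pairing_nonzero[OF f, of "yel b" "yel \<one>"] pairing_center_generic(2)[OF f] c by simp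
  then show ?thesis
    using comm_pairing_commute[of f "zel (b \<otimes> c)" "yel \<one>"] comm_pairing_nonzero[OF f, of "yel \<one>" "zel (b \<otimes> c)"] c
    by (simp add: field_simps)
qed

lemma character_eq_linear_char:
  assumes "A.character h" shows "\<exists>u. \<forall>a\<in>carrier R. h a = linear_char u a"
proof -
  obtain u where "\<And>i. i < r \<Longrightarrow> h (e i) = unity_root n (u i)"
    using A.character_basis_value[OF assms] by metis
  then have "h a = linear_char u a" if "a \<in> carrier R" for a
    by (intro A.character_eqI[OF assms character_linear_char _ that]) (simp add: linear_char_basis)
  then show ?thesis by blast
qed

text \<open>The parameters are read off from the pairings of \<open>f\<close>; \<open>\<kappa>\<close> is left at 0.\<close>

lemma kill_pairings:
  assumes f: "is_cocycle G f"
  shows "\<exists>v. \<forall>a\<in>carrier R. \<forall>b\<in>carrier R.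
     comm_pairing (\<lambda>x y. f x y / heis_cocycle v x y) (zel a) (xel b) = 1 \<and>
     comm_pairing (\<lambda>x y. f x y / heis_cocycle v x y) (yel a) (zel b) = 1 \<and>
     comm_pairing (\<lambda>x y. f x y / heis_cocycle v x y) (xel a) (xel b) = 1 \<and>
     comm_pairing (\<lambda>x y. f x y / heis_cocycle v x y) (yel a) (yel b) = 1"
proof -
  note bich = pairing_central_bicharacters[OF f]
  have "A.character (\<lambda>c. comm_pairing f (zel c) (xel \<one>))"
    using bich(1) by (simp add: A.bicharacter_def)
  then obtain l where l: "\<And>c. c \<in> carrier R \<Longrightarrow> comm_pairing f (zel c) (xel \<one>) = linear_char l c"
    using character_eq_linear_char by blast
  have "A.character (\<lambda>c. comm_pairing f (yel \<one>) (zel c))"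
    using bich(2) by (simp add: A.bicharacter_def)
  then obtain m where m: "\<And>c. c \<in> carrier R \<Longrightarrow> comm_pairing f (yel \<one>) (zel c) = linear_char m c"
    using character_eq_linear_char by blast
  obtain s where s: "\<And>a b. a \<in> carrier R \<Longrightarrow> b \<in> carrier R \<Longrightarrow> comm_pairing f (xel a) (xel b) =
      bilinear_char (\<lambda>i j. if i < j then s i j else 0) a b / bilinear_char (\<lambda>i j. if i < j then s i j else 0) b a"
    using half_of_alternating_bicharacter[OF bich(3), of "(<)"] comm_pairing_self[OF f] by fastforce
  obtain t where t: "\<And>a b. a \<in> carrier R \<Longrightarrow> b \<in> carrier R \<Longrightarrow> comm_pairing f (yel a) (yel b) =
      bilinear_char (\<lambda>i j. if j < i then t i j else 0) a b / bilinear_char (\<lambda>i j. if j < i then t i j else 0) b a"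
    using half_of_alternating_bicharacter[OF bich(4), of "\<lambda>i j. j < i"] comm_pairing_self[OF f] by fastforce
  define v where "v = (\<lambda>(q, i, j). if q then m j else if i = j then l i else if i < j then s i j else t i j)"
  have v: "(\<lambda>i. v (False, i, i)) = l" "(\<lambda>j. v (True, 0, j)) = m"
    "(\<lambda>i j. if i < j then v (False, i, j) else 0) = (\<lambda>i j. if i < j then s i j else 0)"
    "(\<lambda>i j. if j < i then v (False, i, j) else 0) = (\<lambda>i j. if j < i then t i j else 0)"
    by (auto simp: v_def fun_eq_iff)
  have "comm_pairing f (zel a) (xel b) = comm_pairing (heis_cocycle v) (zel a) (xel b) \<and>
     comm_pairing f (yel a) (zel b) = comm_pairing (heis_cocycle v) (yel a) (zel b) \<and>
     comm_pairing f (xel a) (xel b) = comm_pairing (heis_cocycle v) (xel a) (xel b) \<and>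
     comm_pairing f (yel a) (yel b) = comm_pairing (heis_cocycle v) (yel a) (yel b)"
    if "a \<in> carrier R" "b \<in> carrier R" for a b
    unfolding pairing_heis_cocycle[OF that] v
    using that pairing_zx_balanced[OF f that(2,1)] pairing_yz_balanced[OF f that] l m s t by simp
  then show ?thesis
    unfolding comm_pairing_divide
    by (intro exI[of _ v]) (auto simp: comm_pairing_nonzero[OF is_cocycle_heis_cocycle])
qed

end

text \<open>Collecting a product of two words in normal form costs one commutator \<open>g\<close>, from moving \<open>p'\<close> past
  \<open>q\<close>.\<close>

lemma (in group) heisenberg_word_mult:
  assumes c: "p \<in> carrier G" "q \<in> carrier G" "s \<in> carrier G" "p' \<in> carrier G" "q' \<in> carrier G" "s' \<in> carrier G"
      "g \<in> carrier G"
    and qp: "q \<otimes> p' = p' \<otimes> q \<otimes> g"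
    and s: "s \<otimes> p' = p' \<otimes> s" "s \<otimes> q' = q' \<otimes> s" and g: "g \<otimes> q' = q' \<otimes> g"
  shows "(p \<otimes> q \<otimes> s) \<otimes> (p' \<otimes> q' \<otimes> s') = (p \<otimes> p') \<otimes> (q \<otimes> q') \<otimes> g \<otimes> (s \<otimes> s')"
proof -
  have "(p \<otimes> q \<otimes> s) \<otimes> (p' \<otimes> q' \<otimes> s') = p \<otimes> q \<otimes> (s \<otimes> p') \<otimes> q' \<otimes> s'"
    using c by (simp add: m_assoc)
  also have "\<dots> = p \<otimes> (q \<otimes> p') \<otimes> (s \<otimes> q') \<otimes> s'"
    unfolding s(1) using c by (simp add: m_assoc)
  also have "\<dots> = p \<otimes> p' \<otimes> q \<otimes> (g \<otimes> q') \<otimes> s \<otimes> s'"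
    unfolding s(2) qp using c by (simp add: m_assoc)
  also have "\<dots> = (p \<otimes> p') \<otimes> (q \<otimes> q') \<otimes> g \<otimes> (s \<otimes> s')"
    unfolding g using c by (simp add: m_assoc)
  finally show ?thesis .
qed

context heisenberg_basis
begin

text \<open>The last step of the classification: products of lifts of \<open>x\<^sub>a\<close>, \<open>y\<^sub>b\<close> and \<open>z\<^sub>c\<close>, with \<open>z\<^sub>c\<close> lifted to the
  commutator \<open>\<gamma>(1, c)\<close> of the lifts of \<open>y\<^sub>1\<close> and \<open>x\<^sub>c\<close>, form a section that is multiplicative up
  to \<open>\<kappa>(b, a')\<close>.\<close>

lemma cocycle_with_trivial_pairings:
  assumes f: "is_cocycle G f"
    and zx: "\<And>a b. a \<in> carrier R \<Longrightarrow> b \<in> carrier R \<Longrightarrow> comm_pairing f (zel a) (xel b) = 1"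
    and yz: "\<And>a b. a \<in> carrier R \<Longrightarrow> b \<in> carrier R \<Longrightarrow> comm_pairing f (yel a) (zel b) = 1"
    and xx: "\<And>a b. a \<in> carrier R \<Longrightarrow> b \<in> carrier R \<Longrightarrow> comm_pairing f (xel a) (xel b) = 1"
    and yy: "\<And>a b. a \<in> carrier R \<Longrightarrow> b \<in> carrier R \<Longrightarrow> comm_pairing f (yel a) (yel b) = 1"
  shows "\<exists>\<kappa>. A.bicharacter \<kappa> \<and> (\<forall>a\<in>carrier R. \<kappa> \<one> a = 1) \<and>
            is_coboundary G (\<lambda>x y. f x y / \<kappa> (x $ 1 $ 2) (y $ 2 $ 3))"
proof -
  interpret G: group G by (rule group_heisenberg)
  define E where "E = cocycle_extension G f"
  interpret E: group E unfolding E_def by (rule G.group_cocycle_extension[OF f])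
  note nz = cocycle_nonzero[OF f]
  have E_carr: "(u, x) \<in> carrier E \<longleftrightarrow> u \<noteq> 0 \<and> x \<in> carrier G" for u x by (simp add: E_def)
  have E_mult: "(u, x) \<otimes>\<^bsub>E\<^esub> (w, y) = (u * w * f x y, x \<otimes>\<^bsub>G\<^esub> y)" for u w x y by (simp add: E_def)
  have snd_mult: "snd (p \<otimes>\<^bsub>E\<^esub> q) = snd p \<otimes>\<^bsub>G\<^esub> snd q" for p q
    by (cases p; cases q) (simp add: E_mult)
  have pairing_1: "f x y = f y x" if "comm_pairing f x y = 1" for x y
    using that by (auto simp: comm_pairing_def divide_eq_1_iff)

  (* The trivial pairings make the preimage of the centre central in the extension. *)
  have central: "p \<otimes>\<^bsub>E\<^esub> q = q \<otimes>\<^bsub>E\<^esub> p"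
    if p: "snd p = zel d" "d \<in> carrier R" and q: "q \<in> carrier E" for p q d
  proof -
    obtain u where u: "p = (u, zel d)" using p(1) by (cases p) auto
    obtain w y where w: "q = (w, y)" "y \<in> carrier G" using q by (cases q) (auto simp: E_carr)
    from w(2) obtain a b c where y: "a \<in> carrier R" "b \<in> carrier R" "c \<in> carrier R" "y = H a b c"
      by (elim heisenberg_cases)
    have "comm_pairing f (zel d) (yel b) = 1"
      using yz[OF y(2) p(2)] comm_pairing_commute[of f "zel d" "yel b"] by simp
    then have "comm_pairing f (zel d) y = 1"
      using pairing_center_generic(1)[OF f y(1-3) p(2)] zx[OF p(2) y(1)] y(4) by simp
    then have "f (zel d) y = f y (zel d)" by (rule pairing_1)
    moreover have "zel d \<otimes>\<^bsub>G\<^esub> y = y \<otimes>\<^bsub>G\<^esub> zel d" using y p(2) by (simp add: a_comm)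
    ultimately show ?thesis by (simp add: u w E_mult)
  qed

  (* Over the abelian subgroups of the x's and of the y's the cocycle is symmetric. *)
  have lift: "\<exists>\<phi>. (\<forall>a\<in>carrier R. \<phi> a \<noteq> 0) \<and>
      (\<forall>a\<in>carrier R. \<forall>b\<in>carrier R. \<phi> a * \<phi> b * f (s a) (s b) = \<phi> (a \<oplus> b))"
    if s: "\<And>a. a \<in> carrier R \<Longrightarrow> s a \<in> carrier G"
      "\<And>a b. a \<in> carrier R \<Longrightarrow> b \<in> carrier R \<Longrightarrow> s (a \<oplus> b) = s a \<otimes>\<^bsub>G\<^esub> s b"
      "\<And>a b. a \<in> carrier R \<Longrightarrow> b \<in> carrier R \<Longrightarrow> comm_pairing f (s a) (s b) = 1" for s
  proof -
    have "is_cocycle (add_monoid R) (\<lambda>a b. f (s a) (s b))"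
      using f s(1) by (intro is_cocycleI) (simp_all add: is_cocycle_def s(2))
    then have "is_coboundary (add_monoid R) (\<lambda>a b. f (s a) (s b))"
      by (rule A.symmetric_cocycle_is_coboundary) (auto intro: pairing_1 s(3))
    then obtain \<phi> where \<phi>: "\<forall>a\<in>carrier R. \<phi> a \<noteq> 0"
      "\<forall>a\<in>carrier R. \<forall>b\<in>carrier R. f (s a) (s b) = \<phi> a * \<phi> b / \<phi> (a \<oplus> b)"
      unfolding is_coboundary_def by auto
    then show ?thesis by (intro exI[of _ "\<lambda>a. 1 / \<phi> a"]) simp
  qed
  obtain \<phi> where \<phi>: "\<And>a. a \<in> carrier R \<Longrightarrow> \<phi> a \<noteq> 0"
    "\<And>a b. a \<in> carrier R \<Longrightarrow> b \<in> carrier R \<Longrightarrow> \<phi> a * \<phi> b * f (xel a) (xel b) = \<phi> (a \<oplus> b)"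
  proof -
    have "\<exists>\<phi>. (\<forall>a\<in>carrier R. \<phi> a \<noteq> 0) \<and>
        (\<forall>a\<in>carrier R. \<forall>b\<in>carrier R. \<phi> a * \<phi> b * f (xel a) (xel b) = \<phi> (a \<oplus> b))"
      by (rule lift) (simp_all add: xx)
    then show ?thesis using that by blast
  qed
  obtain \<psi> where \<psi>: "\<And>b. b \<in> carrier R \<Longrightarrow> \<psi> b \<noteq> 0"
    "\<And>a b. a \<in> carrier R \<Longrightarrow> b \<in> carrier R \<Longrightarrow> \<psi> a * \<psi> b * f (yel a) (yel b) = \<psi> (a \<oplus> b)"
  proof -
    have "\<exists>\<phi>. (\<forall>a\<in>carrier R. \<phi> a \<noteq> 0) \<and>
        (\<forall>a\<in>carrier R. \<forall>b\<in>carrier R. \<phi> a * \<phi> b * f (yel a) (yel b) = \<phi> (a \<oplus> b))"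
      by (rule lift) (simp_all add: yy)
    then show ?thesis using that by blast
  qed
  define LX where "LX = (\<lambda>a. (\<phi> a, xel a))"
  define LY where "LY = (\<lambda>b. (\<psi> b, yel b))"
  have LX: "LX a \<in> carrier E" and LY: "LY a \<in> carrier E" if "a \<in> carrier R" for a
    using that \<phi> \<psi> by (simp_all add: LX_def LY_def E_carr)
  have LX_add: "LX a \<otimes>\<^bsub>E\<^esub> LX b = LX (a \<oplus> b)" and LY_add: "LY a \<otimes>\<^bsub>E\<^esub> LY b = LY (a \<oplus> b)"
    if "a \<in> carrier R" "b \<in> carrier R" for a b
    using that \<phi> \<psi> by (simp_all add: LX_def LY_def E_mult)

  define \<gamma> where "\<gamma> = (\<lambda>b a. inv\<^bsub>E\<^esub> (LX a \<otimes>\<^bsub>E\<^esub> LY b) \<otimes>\<^bsub>E\<^esub> (LY b \<otimes>\<^bsub>E\<^esub> LX a))"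
  have \<gamma>_closed: "\<gamma> b a \<in> carrier E" if "a \<in> carrier R" "b \<in> carrier R" for a b
    using that LX LY by (simp add: \<gamma>_def)
  have \<gamma>: "LY b \<otimes>\<^bsub>E\<^esub> LX a = LX a \<otimes>\<^bsub>E\<^esub> LY b \<otimes>\<^bsub>E\<^esub> \<gamma> b a" if "a \<in> carrier R" "b \<in> carrier R" for a b
    using that LX LY by (simp add: \<gamma>_def flip: E.m_assoc)
  have \<gamma>_unique: "\<gamma> b a = g"
    if "a \<in> carrier R" "b \<in> carrier R" "g \<in> carrier E" "LY b \<otimes>\<^bsub>E\<^esub> LX a = LX a \<otimes>\<^bsub>E\<^esub> LY b \<otimes>\<^bsub>E\<^esub> g" for a b g
    using that \<gamma>[of a b] \<gamma>_closed[of a b] LX LY by (metis E.l_cancel E.m_closed)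
  have snd_\<gamma>: "snd (\<gamma> b a) = zel (b \<otimes> a)" if ab: "a \<in> carrier R" "b \<in> carrier R" for a b
  proof -
    have "snd (LY b \<otimes>\<^bsub>E\<^esub> LX a) = snd (LX a \<otimes>\<^bsub>E\<^esub> LY b \<otimes>\<^bsub>E\<^esub> \<gamma> b a)" using \<gamma>[OF ab] by simp
    then have "H a b \<zero> \<otimes>\<^bsub>G\<^esub> zel (b \<otimes> a) = H a b \<zero> \<otimes>\<^bsub>G\<^esub> snd (\<gamma> b a)"
      using ab by (simp add: snd_mult LX_def LY_def)
    moreover have "snd (\<gamma> b a) \<in> carrier G"
      using \<gamma>_closed[OF ab] by (cases "\<gamma> b a") (simp add: E_carr)
    ultimately show ?thesis using ab by (metis G.l_cancel heisenberg_closed m_closed zero_closed)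
  qed
  have \<gamma>_central: "\<gamma> b a \<otimes>\<^bsub>E\<^esub> q = q \<otimes>\<^bsub>E\<^esub> \<gamma> b a" if "a \<in> carrier R" "b \<in> carrier R" "q \<in> carrier E" for a b q
    using central[OF snd_\<gamma>] that by simp
  have \<gamma>_add_right: "\<gamma> b (a \<oplus> a') = \<gamma> b a \<otimes>\<^bsub>E\<^esub> \<gamma> b a'"
    if c: "a \<in> carrier R" "a' \<in> carrier R" "b \<in> carrier R" for a a' b
  proof (rule \<gamma>_unique)
    note [simp] = LX LY \<gamma>_closed
    have "LY b \<otimes>\<^bsub>E\<^esub> LX (a \<oplus> a') = (LY b \<otimes>\<^bsub>E\<^esub> LX a) \<otimes>\<^bsub>E\<^esub> LX a'"
      using c by (simp add: E.m_assoc flip: LX_add)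
    also have "\<dots> = LX a \<otimes>\<^bsub>E\<^esub> LY b \<otimes>\<^bsub>E\<^esub> (\<gamma> b a \<otimes>\<^bsub>E\<^esub> LX a')"
      using c by (simp add: \<gamma> E.m_assoc)
    also have "\<dots> = LX a \<otimes>\<^bsub>E\<^esub> (LY b \<otimes>\<^bsub>E\<^esub> LX a') \<otimes>\<^bsub>E\<^esub> \<gamma> b a"
      using c by (simp add: \<gamma>_central[of a b "LX a'"] E.m_assoc)
    also have "\<dots> = LX a \<otimes>\<^bsub>E\<^esub> LX a' \<otimes>\<^bsub>E\<^esub> LY b \<otimes>\<^bsub>E\<^esub> (\<gamma> b a' \<otimes>\<^bsub>E\<^esub> \<gamma> b a)"
      using c by (simp add: \<gamma> E.m_assoc)
    finally show "LY b \<otimes>\<^bsub>E\<^esub> LX (a \<oplus> a') = LX (a \<oplus> a') \<otimes>\<^bsub>E\<^esub> LY b \<otimes>\<^bsub>E\<^esub> (\<gamma> b a \<otimes>\<^bsub>E\<^esub> \<gamma> b a')"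
      using c by (simp add: \<gamma>_central[of a b "\<gamma> b a'"] LX_add)
  qed (use c \<gamma>_closed in auto)
  have \<gamma>_add_left: "\<gamma> (b \<oplus> b') a = \<gamma> b a \<otimes>\<^bsub>E\<^esub> \<gamma> b' a"
    if c: "a \<in> carrier R" "b \<in> carrier R" "b' \<in> carrier R" for a b b'
  proof (rule \<gamma>_unique)
    note [simp] = LX LY \<gamma>_closed
    have "LY (b \<oplus> b') \<otimes>\<^bsub>E\<^esub> LX a = LY b \<otimes>\<^bsub>E\<^esub> (LY b' \<otimes>\<^bsub>E\<^esub> LX a)"
      using c by (simp add: E.m_assoc flip: LY_add)
    also have "\<dots> = (LY b \<otimes>\<^bsub>E\<^esub> LX a) \<otimes>\<^bsub>E\<^esub> LY b' \<otimes>\<^bsub>E\<^esub> \<gamma> b' a"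
      using c by (simp add: \<gamma>[of a b'] E.m_assoc)
    also have "\<dots> = LX a \<otimes>\<^bsub>E\<^esub> LY b \<otimes>\<^bsub>E\<^esub> (\<gamma> b a \<otimes>\<^bsub>E\<^esub> LY b') \<otimes>\<^bsub>E\<^esub> \<gamma> b' a"
      using c by (simp add: \<gamma> E.m_assoc)
    also have "\<dots> = LX a \<otimes>\<^bsub>E\<^esub> (LY b \<otimes>\<^bsub>E\<^esub> LY b') \<otimes>\<^bsub>E\<^esub> (\<gamma> b a \<otimes>\<^bsub>E\<^esub> \<gamma> b' a)"
      using c by (simp add: \<gamma>_central[of a b "LY b'"] E.m_assoc)
    finally show "LY (b \<oplus> b') \<otimes>\<^bsub>E\<^esub> LX a = LX a \<otimes>\<^bsub>E\<^esub> LY (b \<oplus> b') \<otimes>\<^bsub>E\<^esub> (\<gamma> b a \<otimes>\<^bsub>E\<^esub> \<gamma> b' a)"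
      using c by (simp add: LY_add)
  qed (use c \<gamma>_closed in auto)

  define g where "g = (\<lambda>b a. fst (\<gamma> b a))"
  have \<gamma>_eq: "\<gamma> b a = (g b a, zel (b \<otimes> a))" if "a \<in> carrier R" "b \<in> carrier R" for a b
    using snd_\<gamma>[OF that] by (simp add: g_def prod_eq_iff)
  have g_nz: "g b a \<noteq> 0" if "a \<in> carrier R" "b \<in> carrier R" for a b
    using \<gamma>_closed[OF that] \<gamma>_eq[OF that] by (simp add: E_carr)
  have g_right: "g b (a \<oplus> a') = g b a * g b a' * f (zel (b \<otimes> a)) (zel (b \<otimes> a'))"
    if "a \<in> carrier R" "a' \<in> carrier R" "b \<in> carrier R" for a a' b
    using \<gamma>_add_right[OF that] that by (simp add: \<gamma>_eq E_mult)
  have g_left: "g (b \<oplus> b') a = g b a * g b' a * f (zel (b \<otimes> a)) (zel (b' \<otimes> a))"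
    if "a \<in> carrier R" "b \<in> carrier R" "b' \<in> carrier R" for a b b'
    using \<gamma>_add_left[OF that] that by (simp add: \<gamma>_eq E_mult)

  (* Both numerator and denominator of kappa acquire the same factor f(z, z') under addition,
     so kappa is bimultiplicative although g is not. *)
  define \<kappa> where "\<kappa> = (\<lambda>b a. g b a / g \<one> (b \<otimes> a))"
  have \<kappa>_nz: "\<kappa> b a \<noteq> 0" if "a \<in> carrier R" "b \<in> carrier R" for a b
    using that g_nz by (simp add: \<kappa>_def)
  have \<kappa>: "A.bicharacter \<kappa>"
  proof (rule A.bicharacterI)
    fix a b c assume c: "a \<in> carrier R" "b \<in> carrier R" "c \<in> carrier R"
    show "\<kappa> (a \<oplus> b) c = \<kappa> a c * \<kappa> b c"
      using c g_left[of c a b] g_right[of "a \<otimes> c" "b \<otimes> c" \<one>] nz g_nz by (simp add: \<kappa>_def l_distr)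
    show "\<kappa> a (b \<oplus> c) = \<kappa> a b * \<kappa> a c"
      using c g_right[of b c a] g_right[of "a \<otimes> b" "a \<otimes> c" \<one>] nz g_nz by (simp add: \<kappa>_def r_distr)
  qed (use \<kappa>_nz in auto)
  have \<kappa>_one: "\<kappa> \<one> a = 1" if "a \<in> carrier R" for a
    using that g_nz by (simp add: \<kappa>_def)

  (* The section.  Choosing gamma(1, c) over the centre makes kappa the only defect: collecting
     T x T y produces gamma(b, a') where T (x y) has gamma(1, b a'). *)
  define T where "T = (\<lambda>x :: 'a^3^3. LX (x $ 2 $ 3) \<otimes>\<^bsub>E\<^esub> LY (x $ 1 $ 2) \<otimes>\<^bsub>E\<^esub> \<gamma> \<one> (x $ 1 $ 3))"
  define \<tau> where "\<tau> = (\<lambda>x. fst (T x))"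
  have T_closed: "T x \<in> carrier E" if "x \<in> carrier G" for x
    using that by (elim heisenberg_cases) (simp add: T_def LX LY \<gamma>_closed)
  have snd_T: "snd (T x) = x" if "x \<in> carrier G" for x
    using that by (elim heisenberg_cases) (simp add: T_def snd_mult LX_def LY_def snd_\<gamma>)
  have T_eq: "T x = (\<tau> x, x)" if "x \<in> carrier G" for x
    using snd_T[OF that] by (simp add: \<tau>_def prod_eq_iff)
  have \<tau>_nz: "\<tau> x \<noteq> 0" if "x \<in> carrier G" for x
    using T_closed[OF that] T_eq[OF that] by (simp add: E_carr)
  have key: "\<tau> x * \<tau> y * f x y = \<kappa> (x $ 1 $ 2) (y $ 2 $ 3) * \<tau> (x \<otimes>\<^bsub>G\<^esub> y)"
    if x: "x \<in> carrier G" and y: "y \<in> carrier G" for x y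
  proof -
    obtain a b c where xs: "a \<in> carrier R" "b \<in> carrier R" "c \<in> carrier R" "x = H a b c"
      using x by (elim heisenberg_cases)
    obtain a' b' c' where ys: "a' \<in> carrier R" "b' \<in> carrier R" "c' \<in> carrier R" "y = H a' b' c'"
      using y by (elim heisenberg_cases)
    note [simp] = LX LY \<gamma>_closed xs(1-3) ys(1-3)
    (* Multiplication by a scalar k of the first component commutes with products. *)
    have scalar: "(k * u, z) \<otimes>\<^bsub>E\<^esub> q = (k * fst ((u, z) \<otimes>\<^bsub>E\<^esub> q), snd ((u, z) \<otimes>\<^bsub>E\<^esub> q))"
      "q \<otimes>\<^bsub>E\<^esub> (k * u, z) = (k * fst (q \<otimes>\<^bsub>E\<^esub> (u, z)), snd (q \<otimes>\<^bsub>E\<^esub> (u, z)))" for k u z q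
      by (cases q, simp add: E_mult)+
    have "T x \<otimes>\<^bsub>E\<^esub> T y = LX (a \<oplus> a') \<otimes>\<^bsub>E\<^esub> LY (b \<oplus> b') \<otimes>\<^bsub>E\<^esub> \<gamma> b a' \<otimes>\<^bsub>E\<^esub> (\<gamma> \<one> c \<otimes>\<^bsub>E\<^esub> \<gamma> \<one> c')"
      using E.heisenberg_word_mult[of "LX a" "LY b" "\<gamma> \<one> c" "LX a'" "LY b'" "\<gamma> \<one> c'" "\<gamma> b a'",
          OF _ _ _ _ _ _ _ \<gamma> \<gamma>_central \<gamma>_central \<gamma>_central]
      by (simp add: T_def xs(4) ys(4) LX_add LY_add)
    also have "\<gamma> \<one> c \<otimes>\<^bsub>E\<^esub> \<gamma> \<one> c' = \<gamma> \<one> (c \<oplus> c')"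
      by (simp add: \<gamma>_add_right)
    finally have 1: "T x \<otimes>\<^bsub>E\<^esub> T y = LX (a \<oplus> a') \<otimes>\<^bsub>E\<^esub> LY (b \<oplus> b') \<otimes>\<^bsub>E\<^esub> (\<gamma> b a' \<otimes>\<^bsub>E\<^esub> \<gamma> \<one> (c \<oplus> c'))"
      by (simp add: E.m_assoc)
    have "T (x \<otimes>\<^bsub>G\<^esub> y) = LX (a \<oplus> a') \<otimes>\<^bsub>E\<^esub> LY (b \<oplus> b') \<otimes>\<^bsub>E\<^esub> \<gamma> \<one> (c \<oplus> c' \<oplus> b \<otimes> a')"
      by (simp add: T_def xs(4) ys(4))
    also have "\<gamma> \<one> (c \<oplus> c' \<oplus> b \<otimes> a') = \<gamma> \<one> (b \<otimes> a') \<otimes>\<^bsub>E\<^esub> \<gamma> \<one> (c \<oplus> c')"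
      by (simp add: a_comm flip: \<gamma>_add_right)
    finally have 2: "T (x \<otimes>\<^bsub>G\<^esub> y) = LX (a \<oplus> a') \<otimes>\<^bsub>E\<^esub> LY (b \<oplus> b') \<otimes>\<^bsub>E\<^esub> (\<gamma> \<one> (b \<otimes> a') \<otimes>\<^bsub>E\<^esub> \<gamma> \<one> (c \<oplus> c'))" .
    have "\<gamma> b a' = (\<kappa> b a' * g \<one> (b \<otimes> a'), zel (b \<otimes> a'))"
      using g_nz[of "b \<otimes> a'" \<one>] by (simp add: \<gamma>_eq \<kappa>_def)
    then have "fst (T x \<otimes>\<^bsub>E\<^esub> T y) = \<kappa> b a' * fst (T (x \<otimes>\<^bsub>G\<^esub> y))"
      unfolding 1 2 using \<gamma>_eq[of "b \<otimes> a'" \<one>] by (simp only: scalar fst_conv) simp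
    then show ?thesis
      using x y by (simp add: T_eq E_mult) (simp add: xs ys)
  qed
  have "f x y / \<kappa> (x $ 1 $ 2) (y $ 2 $ 3) = (1 / \<tau> x) * (1 / \<tau> y) / (1 / \<tau> (x \<otimes>\<^bsub>G\<^esub> y))"
    if "x \<in> carrier G" "y \<in> carrier G" for x y
    using key[OF that] that \<tau>_nz \<kappa>_nz[of "y $ 2 $ 3" "x $ 1 $ 2"] entry_hom[OF that] entry_hom[OF that(2,1)]
    by (simp add: field_simps)
  then have "is_coboundary G (\<lambda>x y. f x y / \<kappa> (x $ 1 $ 2) (y $ 2 $ 3))"
    unfolding is_coboundary_def using \<tau>_nz by (intro exI[of _ "\<lambda>x. 1 / \<tau> x"]) auto
  with \<kappa> \<kappa>_one show ?thesis by blast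
qed

lemma heis_cocycle_surjective:
  assumes f: "is_cocycle G f"
  shows "\<exists>v. is_coboundary G (\<lambda>x y. f x y / heis_cocycle v x y)"
proof -
  obtain v where v: "\<forall>a\<in>carrier R. \<forall>b\<in>carrier R.
     comm_pairing (\<lambda>x y. f x y / heis_cocycle v x y) (zel a) (xel b) = 1 \<and>
     comm_pairing (\<lambda>x y. f x y / heis_cocycle v x y) (yel a) (zel b) = 1 \<and>
     comm_pairing (\<lambda>x y. f x y / heis_cocycle v x y) (xel a) (xel b) = 1 \<and>
     comm_pairing (\<lambda>x y. f x y / heis_cocycle v x y) (yel a) (yel b) = 1"
    using kill_pairings[OF f] by blast
  then obtain \<kappa> where \<kappa>: "A.bicharacter \<kappa>" "\<forall>a\<in>carrier R. \<kappa> \<one> a = 1"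
    and cob: "is_coboundary G (\<lambda>x y. f x y / heis_cocycle v x y / \<kappa> (x $ 1 $ 2) (y $ 2 $ 3))"
    using cocycle_with_trivial_pairings[OF is_cocycle_divide[OF f is_cocycle_heis_cocycle[of v]]] by blast
  obtain u where u: "\<And>i j. i < r \<Longrightarrow> j < r \<Longrightarrow> \<kappa> (e i) (e j) = unity_root n (u i j)"
    using A.bicharacter_basis_values[OF \<kappa>(1)] by blast
  define w where "w = (\<lambda>(q, i, j). if q \<and> i \<noteq> 0 then u i j else 0)"
  have \<kappa>_eq: "\<kappa> a b = bilinear_char (\<lambda>i j. if i = 0 then 0 else u i j) a b" if "a \<in> carrier R" "b \<in> carrier R" for a b
  proof (rule A.bicharacter_eqI[OF \<kappa>(1) bicharacter_bilinear_char _ that])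
    fix i j assume ij: "i < r" "j < r"
    show "\<kappa> (e i) (e j) = bilinear_char (\<lambda>i j. if i = 0 then 0 else u i j) (e i) (e j)"
      unfolding bilinear_char_basis[OF ij] using ij \<kappa>(2) by (cases "i = 0") (simp_all add: e_0 u)
  qed
  have Fw: "heis_cocycle w x y = \<kappa> (x $ 1 $ 2) (y $ 2 $ 3)" if "x \<in> carrier G" "y \<in> carrier G" for x y
  proof -
    have zero: "linear_char (\<lambda>_. 0) a = 1" "bilinear_char (\<lambda>_ _. 0) a b = 1" for a b
      by (simp_all add: linear_char_def bilinear_char_def)
    have "(\<lambda>i j. if i = 0 then 0 else w (True, i, j)) = (\<lambda>i j. if i = 0 then 0 else u i j)"
      "(\<lambda>i j. if i < j then w (False, i, j) else 0) = (\<lambda>_ _. 0)"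
      "(\<lambda>i j. if j < i then w (False, i, j) else 0) = (\<lambda>_ _. 0)"
      "(\<lambda>i. w (False, i, i)) = (\<lambda>_. 0)" "(\<lambda>j. w (True, 0, j)) = (\<lambda>_. 0)"
      by (auto simp: w_def fun_eq_iff)
    then show ?thesis
      using entry_hom[OF that] entry_hom[OF that(2,1)]
      by (simp add: heis_cocycle_def \<kappa>_eq zero)
  qed
  have "is_coboundary G (\<lambda>x y. f x y / heis_cocycle (\<lambda>i. v i + w i) x y)"
    using cob unfolding is_coboundary_def heis_cocycle_add by (simp add: Fw)
  then show ?thesis by blast
qed

theorem H2_heisenberg_group:
  "H2 G complex_units \<cong> product_group (UNIV \<times> {..<r} \<times> {..<r} :: (bool \<times> nat \<times> nat) set) (\<lambda>_. integer_mod_group n)"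
  by (rule H2_iso_product_group[of G n heis_cocycle])
     (use group_heisenberg A.n_pos is_cocycle_heis_cocycle heis_cocycle_add heis_cocycle_periodic heis_cocycle_coboundary_trivial heis_cocycle_surjective in auto)

end

section \<open>Rings of prime square order\<close>

lemma (in heisenberg_basis) H2_heisenberg_group_lessThan:
  "H2 G complex_units \<cong> product_group {..<2 * r * r} (\<lambda>_. integer_mod_group n)"
proof -
  let ?I = "UNIV \<times> {..<r} \<times> {..<r} :: (bool \<times> nat \<times> nat) set"
  have "finite ?I" "card ?I = card {..<2 * r * r}" by (simp_all add: card_cartesian_product)
  then obtain h where "bij_betw h {..<2 * r * r} ?I"
    by (metis finite_same_card_bij finite_lessThan)
  then show ?thesis
    by (rule iso_trans[OF H2_heisenberg_group product_group_reindex])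
qed

lemma ring_hom_add_pow_one:
  assumes "ring R" "ring S" "h \<in> ring_hom R S" "add_pow R (k::nat) \<one>\<^bsub>R\<^esub> = \<zero>\<^bsub>R\<^esub>"
  shows "add_pow S k \<one>\<^bsub>S\<^esub> = \<zero>\<^bsub>S\<^esub>"
proof -
  interpret h: ring_hom_ring R S h using assms by (simp add: ring_hom_ringI2)
  have "h (add_pow R k \<one>\<^bsub>R\<^esub>) = add_pow S k \<one>\<^bsub>S\<^esub>"
    by (induction k) simp_all
  then show ?thesis using assms(4) by simp
qed

lemma cring_of_ring_iso:
  assumes "ring R" "cring S" "R \<simeq> S" shows "cring R"
proof -
  interpret R: ring R by fact
  interpret S: cring S by fact
  obtain h where h: "h \<in> ring_iso R S" using assms(3) by (auto simp: is_ring_iso_def)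
  note hE = ring_iso_memE[OF h]
  have "x \<otimes>\<^bsub>R\<^esub> y = y \<otimes>\<^bsub>R\<^esub> x" if "x \<in> carrier R" "y \<in> carrier R" for x y
  proof -
    have "h (x \<otimes>\<^bsub>R\<^esub> y) = h (y \<otimes>\<^bsub>R\<^esub> x)" using hE(1,2) that S.m_comm by simp
    then show ?thesis using hE(5) that by (auto simp: bij_betw_def inj_on_def)
  qed
  then show ?thesis
    by (intro cring.intro assms(1) comm_monoid.intro R.monoid_axioms comm_monoid_axioms.intro)
qed

lemma (in residues) add_pow_one: "add_pow R (k::nat) \<one> = int k mod m"
  by (induction k) (simp_all add: res_zero_eq res_add_eq res_one_eq mod_simps add.commute)

lemma residue_ring_add_pow_order:
  assumes "m > 1" shows "add_pow (residue_ring (int m)) m \<one>\<^bsub>residue_ring (int m)\<^esub> = \<zero>\<^bsub>residue_ring (int m)\<^esub>"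
proof -
  interpret residues "int m" "residue_ring (int m)" using assms by unfold_locales auto
  show ?thesis by (simp add: add_pow_one res_zero_eq)
qed

lemma ring_hom_of_ring_iso:
  assumes "ring R" "R \<simeq> S" shows "\<exists>h. h \<in> ring_hom S R"
proof -
  have "S \<simeq> R" by (rule ring_iso_sym[OF assms])
  then show ?thesis by (auto simp: is_ring_iso_def ring_iso_def)
qed

text \<open>The homomorphism from the field of constants is what gives \<open>p \<cdot> 1 = 0\<close> in the dual numbers.\<close>

lemma dual_numbers_properties:
  assumes "Factorial_Ring.prime p"
  shows "cring (dual_numbers (residue_ring (int p)))"
    and "\<exists>h. h \<in> ring_hom (residue_ring (int p)) (dual_numbers (residue_ring (int p)))"
proof -
  define K where "K = residue_ring (int p)"
  interpret K: residues_prime p K unfolding K_def using assms by unfold_locales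
  interpret K: field K by (rule K.is_field[folded K_def])
  interpret P: cring "poly_ring K" by (rule K.univ_poly_is_cring[OF K.carrier_is_subring])
  have "X\<^bsub>K\<^esub> \<in> carrier (poly_ring K)" by (rule K.var_closed(1)[OF K.carrier_is_subring])
  then interpret I: ideal "PIdl\<^bsub>poly_ring K\<^esub> (X\<^bsub>K\<^esub> [^]\<^bsub>poly_ring K\<^esub> (2::nat))" "poly_ring K"
    by (intro P.cgenideal_ideal) simp
  show "cring (dual_numbers (residue_ring (int p)))"
    unfolding dual_numbers_def K_def[symmetric] by (rule I.quotient_is_cring) unfold_locales
  have "K.poly_of_const \<in> ring_hom K (poly_ring K)"
    using K.canonical_embedding_is_hom[OF K.carrier_is_subring] by simp
  from ring_hom_trans[OF this I.rcos_ring_hom]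
  show "\<exists>h. h \<in> ring_hom (residue_ring (int p)) (dual_numbers (residue_ring (int p)))"
    unfolding dual_numbers_def K_def[symmetric] by blast
qed

lemma RDirProd_cring:
  assumes "cring R" "cring S" shows "cring (RDirProd R S)"
proof -
  interpret R: cring R by fact
  interpret S: cring S by fact
  interpret P: ring "RDirProd R S" by (rule RDirProd_ring) unfold_locales
  show ?thesis
    by (intro cring.intro P.ring_axioms comm_monoid.intro P.monoid_axioms comm_monoid_axioms.intro)
       (auto simp: RDirProd_carrier RDirProd_def DirProd_def monoid.defs R.m_comm S.m_comm)
qed

text \<open>The additive order of the unit divides \<open>q\<^sup>2\<close>, so \<open>(q \<cdot> 1)\<^sup>2 = 0\<close>.\<close>

lemma (in field) add_pow_one_order_square:
  assumes "order R = q\<^sup>2" shows "add_pow R q \<one> = \<zero>"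
proof -
  have "add_pow R (q * q) \<one> = \<zero>"
    using add.pow_order_eq_1[of \<one>] assms by (simp add: order_def power2_eq_square)
  moreover have "add_pow R q \<one> \<otimes> add_pow R q \<one> = add_pow R q (add_pow R q \<one>)"
    using add_pow_ldistr[of \<one> "add_pow R q \<one>" q] by simp
  moreover have "add_pow R q (add_pow R q \<one>) = add_pow R (q * q) \<one>"
    by (simp add: add.nat_pow_pow)
  ultimately have "add_pow R q \<one> \<otimes> add_pow R q \<one> = \<zero>" by simp
  then show ?thesis by (simp add: integral_iff)
qed

text \<open>Here the ring is a vector space over the field with \<open>p\<close> elements, of dimension 2 by counting,
  and the unit together with any \<open>t\<close> outside its multiples is a basis.\<close>

lemma heisenberg_basis_prime_square:
  assumes p: "Factorial_Ring.prime p" "odd p" and R: "cring R" "order R = p\<^sup>2"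
    and char: "add_pow R p \<one>\<^bsub>R\<^esub> = \<zero>\<^bsub>R\<^esub>"
  shows "\<exists>e \<pi>. heisenberg_basis R p 2 e \<pi>"
proof -
  interpret cring R by fact
  have p1: "p > 1" using p(1) by (rule prime_gt_1_nat)
  have card: "card (carrier R) = p * p" using R(2) by (simp add: order_def power2_eq_square)
  have fin: "finite (carrier R)" using card p1 by (metis card.infinite mult_eq_0_iff not_one_less_zero)
  have int_add_pow: "add_pow R (int k) x = add_pow R k x" for k x
    by (simp add: add_pow_def int_pow_int)
  have add_pow_0_iff: "add_pow R k \<one>\<^bsub>R\<^esub> = \<zero>\<^bsub>R\<^esub> \<longleftrightarrow> int p dvd k" for k :: int
  proof -
    have "add.ord \<one>\<^bsub>R\<^esub> dvd p" using char add.pow_eq_id[of "\<one>\<^bsub>R\<^esub>" p] by simp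
    then have "add.ord \<one>\<^bsub>R\<^esub> = 1 \<or> add.ord \<one>\<^bsub>R\<^esub> = p" using p(1) by (auto simp: prime_nat_iff)
    moreover have "add.ord \<one>\<^bsub>R\<^esub> \<noteq> 1"
    proof
      assume "add.ord \<one>\<^bsub>R\<^esub> = 1"
      then have "\<one>\<^bsub>R\<^esub> = \<zero>\<^bsub>R\<^esub>" using add.ord_eq_1[of "\<one>\<^bsub>R\<^esub>"] by simp
      then have "carrier R = {\<zero>\<^bsub>R\<^esub>}" using one_zeroD by blast
      then show False using card p1 by simp
    qed
    ultimately show ?thesis using add.int_pow_eq_id[of "\<one>\<^bsub>R\<^esub>" k] by simp
  qed
  have "card ((\<lambda>k. add_pow R k \<one>\<^bsub>R\<^esub>) ` {..<p}) \<le> p" using card_image_le[of "{..<p}"] by simp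
  also have "p < card (carrier R)" using p1 card by simp
  finally obtain t where t: "t \<in> carrier R" "t \<notin> (\<lambda>k. add_pow R k \<one>\<^bsub>R\<^esub>) ` {..<p}"
    by (metis card_mono finite_imageI finite_lessThan leD subsetI)
  have pt: "add_pow R p t = \<zero>\<^bsub>R\<^esub>"
    using add_pow_ldistr[of "\<one>\<^bsub>R\<^esub>" t p] char t by simp
  have t': "t \<noteq> add_pow R k \<one>\<^bsub>R\<^esub>" for k :: int
  proof
    assume k: "t = add_pow R k \<one>\<^bsub>R\<^esub>"
    obtain j where j: "int j = k mod int p" using p1 by (metis nat_0_le pos_mod_sign of_nat_0_less_iff less_trans zero_less_one)
    have "add_pow R (k - int j) \<one>\<^bsub>R\<^esub> = \<zero>\<^bsub>R\<^esub>"
      by (simp add: add_pow_0_iff j minus_mod_eq_mult_div)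
    then have "t = add_pow R j \<one>\<^bsub>R\<^esub>"
      using k by (simp add: add.int_pow_diff int_add_pow flip: a_minus_def)
    moreover have "j < p" using j p1 by (metis of_nat_less_iff pos_mod_bound of_nat_0_less_iff less_trans zero_less_one)
    ultimately show False using t(2) by blast
  qed
  define \<Phi> where "\<Phi> = (\<lambda>(i::nat, j::nat). add_pow R i \<one>\<^bsub>R\<^esub> \<oplus>\<^bsub>R\<^esub> add_pow R j t)"
  have uniq: "[i = i'] (mod p) \<and> [j = j'] (mod p)" if "\<Phi> (i, j) = \<Phi> (i', j')" for i j i' j'
  proof -
    (* The relation reads k 1 = l t.  If p did not divide l, inverting l modulo p would make t a
       multiple of the unit. *)
    define k l where "k = int i - int i'" and "l = int j' - int j"
    have move: "A \<ominus>\<^bsub>R\<^esub> C = D \<ominus>\<^bsub>R\<^esub> B"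
      if "A \<oplus>\<^bsub>R\<^esub> B = C \<oplus>\<^bsub>R\<^esub> D" "A \<in> carrier R" "B \<in> carrier R" "C \<in> carrier R" "D \<in> carrier R" for A B C D
    proof -
      have "A \<ominus>\<^bsub>R\<^esub> C = (A \<oplus>\<^bsub>R\<^esub> B) \<ominus>\<^bsub>R\<^esub> (C \<oplus>\<^bsub>R\<^esub> B)" using that(2-) by algebra
      also have "\<dots> = D \<ominus>\<^bsub>R\<^esub> B" unfolding that(1) using that(2-)
        by (simp add: a_minus_def minus_add a_comm[of C D] a_assoc r_neg2)
      finally show ?thesis .
    qed
    have kl: "add_pow R k \<one>\<^bsub>R\<^esub> = add_pow R l t"
      using move[of "add_pow R i \<one>\<^bsub>R\<^esub>" "add_pow R j t" "add_pow R i' \<one>\<^bsub>R\<^esub>" "add_pow R j' t"] that t(1)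
      by (simp add: \<Phi>_def k_def l_def add.int_pow_diff int_add_pow a_minus_def)
    have "add.ord t dvd p" using pt add.pow_eq_id[OF t(1), of p] by simp
    then have t_pow: "add_pow R q t = \<zero>\<^bsub>R\<^esub>" if "int p dvd q" for q :: int
      using that add.int_pow_eq_id[OF t(1), of q] by (meson dvd_trans of_nat_dvd_iff)
    have "int p dvd l"
    proof (rule ccontr)
      assume "\<not> int p dvd l"
      then have "coprime l (int p)"
        using p(1) by (metis coprime_commute prime_imp_coprime prime_int_nat_transfer prime_nat_int_transfer)
      then obtain q where "[l * q = 1] (mod int p)" using cong_solve_coprime_int by blast
      then have "add_pow R (l * q - 1) t = \<zero>\<^bsub>R\<^esub>" by (intro t_pow) (simp add: cong_iff_dvd_diff)
      then have "add_pow R (l * q) t = t"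
        using t(1) by (simp add: add.int_pow_diff add.inv_eq_1_iff r_right_minus_eq flip: a_minus_def)
      then have "t = add_pow R q (add_pow R l t)" using t(1) by (simp add: add.int_pow_pow)
      then have "t = add_pow R (k * q) \<one>\<^bsub>R\<^esub>" unfolding kl[symmetric] by (simp add: add.int_pow_pow)
      with t' show False by blast
    qed
    moreover from this have "int p dvd k" using kl t_pow add_pow_0_iff by simp
    ultimately have "[int i = int i'] (mod int p)" "[int j' = int j] (mod int p)"
      by (simp_all add: cong_iff_dvd_diff k_def l_def)
    then show ?thesis by (simp only: cong_int_iff) (simp add: cong_sym_eq)
  qed
  have "inj_on \<Phi> ({..<p} \<times> {..<p})"
    by (auto intro!: inj_onI dest!: uniq simp: cong_def)
  moreover have "\<Phi> ` ({..<p} \<times> {..<p}) \<subseteq> carrier R" using t by (auto simp: \<Phi>_def)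
  ultimately have surj: "\<Phi> ` ({..<p} \<times> {..<p}) = carrier R"
    using card fin by (intro card_subset_eq) (simp_all add: card_image card_cartesian_product)
  then have "\<forall>a. \<exists>i j. a \<in> carrier R \<longrightarrow> a = \<Phi> (i, j)" by (auto simp: image_iff)
  then obtain c d where cd: "\<And>a. a \<in> carrier R \<Longrightarrow> a = \<Phi> (c a, d a)" by metis
  define e where "e = (\<lambda>i::nat. if i = 0 then \<one>\<^bsub>R\<^esub> else t)"
  define \<pi> where "\<pi> = (\<lambda>i a. if i = (0::nat) then c a else d a)"
  have two: "i = 0 \<or> i = 1" if "i < 2" for i :: nat using that by auto
  have coord: "[c (a \<oplus>\<^bsub>R\<^esub> b) = c a + c b] (mod p) \<and> [d (a \<oplus>\<^bsub>R\<^esub> b) = d a + d b] (mod p)"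
    if ab: "a \<in> carrier R" "b \<in> carrier R" for a b
  proof (rule uniq)
    have "\<Phi> (c a + c b, d a + d b) = \<Phi> (c a, d a) \<oplus>\<^bsub>R\<^esub> \<Phi> (c b, d b)"
      using t(1) by (simp add: \<Phi>_def a_ac flip: add.nat_pow_mult)
    then show "\<Phi> (c (a \<oplus>\<^bsub>R\<^esub> b), d (a \<oplus>\<^bsub>R\<^esub> b)) = \<Phi> (c a + c b, d a + d b)"
      using cd[of a] cd[of b] cd[of "a \<oplus>\<^bsub>R\<^esub> b"] ab by simp
  qed
  have basis_coord: "[c \<one>\<^bsub>R\<^esub> = 1] (mod p) \<and> [d \<one>\<^bsub>R\<^esub> = 0] (mod p)" "[c t = 0] (mod p) \<and> [d t = 1] (mod p)"
    using t(1) cd[of "\<one>\<^bsub>R\<^esub>"] cd[of t] by (intro uniq; simp add: \<Phi>_def)+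
  have "heisenberg_basis R p 2 e \<pi>"
  proof (intro heisenberg_basis.intro heisenberg_basis_axioms.intro zn_basis.intro zn_basis_axioms.intro)
    fix a assume "a \<in> carrier (add_monoid R)"
    then have a: "a \<in> carrier R" by simp
    have "(\<Otimes>\<^bsub>add_monoid R\<^esub>i\<in>{..<2}. e i [^]\<^bsub>add_monoid R\<^esub> \<pi> i a) = add_pow R (c a) \<one>\<^bsub>R\<^esub> \<oplus>\<^bsub>R\<^esub> add_pow R (d a) t"
    proof -
      have "(\<Oplus>\<^bsub>R\<^esub>i\<in>{..<2}. add_pow R (\<pi> i a) (e i)) = add_pow R (c a) \<one>\<^bsub>R\<^esub> \<oplus>\<^bsub>R\<^esub> add_pow R (d a) t"
        using t(1) by (simp add: numeral_2_eq_2 lessThan_Suc e_def \<pi>_def a_comm)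
      then show ?thesis by (simp add: finsum_def add_pow_def)
    qed
    then show "a = (\<Otimes>\<^bsub>add_monoid R\<^esub>i\<in>{..<2}. e i [^]\<^bsub>add_monoid R\<^esub> \<pi> i a)"
      using cd[OF a] by (simp add: \<Phi>_def)
  qed (use R(1) p(2) p1 char pt t two coord basis_coord in
        \<open>auto simp: e_def \<pi>_def add_pow_def a_comm_group dest!: two\<close>)
  then show ?thesis by blast
qed

text \<open>The unit generates the additive group, and the isomorphism to \<open>\<int>/m\<close> is the coordinate.\<close>

lemma heisenberg_basis_residue_ring:
  assumes m: "m > 1" "odd m" and R: "ring R" "R \<simeq> residue_ring (int m)"
  shows "\<exists>e \<pi>. heisenberg_basis R m 1 e \<pi>"
proof -
  interpret S: residues "int m" "residue_ring (int m)" using m by unfold_locales auto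
  have "cring R" by (rule cring_of_ring_iso[OF R(1) S.cring R(2)])
  then interpret cring R .
  obtain g where g: "g \<in> ring_iso R (residue_ring (int m))" using R(2) by (auto simp: is_ring_iso_def)
  note gE = ring_iso_memE[OF g]
  have g_range: "0 \<le> g a" "g a < int m" if "a \<in> carrier R" for a
    using gE(1)[OF that] by (auto simp: S.res_carrier_eq)
  have g_zero: "g \<zero>\<^bsub>R\<^esub> = 0"
    using ring_hom_zero[OF _ R(1) S.ring_axioms] g by (simp add: ring_iso_def S.res_zero_eq)
  have g_pow: "g (add_pow R (k::nat) \<one>\<^bsub>R\<^esub>) = int k mod int m" for k
    using gE m by (induction k) (simp_all add: g_zero S.res_add_eq S.res_one_eq mod_simps add.commute)
  have g_inj: "a = b" if "g a = g b" "a \<in> carrier R" "b \<in> carrier R" for a b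
    using gE(5) that by (auto simp: bij_betw_def inj_on_def)
  have "heisenberg_basis R m 1 (\<lambda>_. \<one>\<^bsub>R\<^esub>) (\<lambda>_ a. nat (g a))"
  proof (intro heisenberg_basis.intro heisenberg_basis_axioms.intro zn_basis.intro zn_basis_axioms.intro)
    show "\<one>\<^bsub>R\<^esub> [^]\<^bsub>add_monoid R\<^esub> m = \<one>\<^bsub>add_monoid R\<^esub>"
    proof -
      have "add_pow R m \<one>\<^bsub>R\<^esub> = \<zero>\<^bsub>R\<^esub>" by (rule g_inj) (simp_all add: g_pow g_zero)
      then show ?thesis by (simp add: add_pow_def)
    qed
    fix a assume "a \<in> carrier (add_monoid R)"
    then have a: "a \<in> carrier R" by simp
    have "a = add_pow R (nat (g a)) \<one>\<^bsub>R\<^esub>"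
      by (rule g_inj) (use a g_range[OF a] in \<open>simp_all add: g_pow\<close>)
    moreover have "(\<Otimes>\<^bsub>add_monoid R\<^esub>i\<in>{..<1::nat}. \<one>\<^bsub>R\<^esub> [^]\<^bsub>add_monoid R\<^esub> nat (g a)) = add_pow R (nat (g a)) \<one>\<^bsub>R\<^esub>"
    proof -
      have "(\<Oplus>\<^bsub>R\<^esub>i\<in>{..<1::nat}. add_pow R (nat (g a)) \<one>\<^bsub>R\<^esub>) = add_pow R (nat (g a)) \<one>\<^bsub>R\<^esub>"
        by (simp add: lessThan_Suc)
      then show ?thesis by (simp add: finsum_def add_pow_def)
    qed
    ultimately show "a = (\<Otimes>\<^bsub>add_monoid R\<^esub>i\<in>{..<1::nat}. \<one>\<^bsub>R\<^esub> [^]\<^bsub>add_monoid R\<^esub> nat (g a))" by simp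
    fix b assume "b \<in> carrier (add_monoid R)"
    then have b: "b \<in> carrier R" by simp
    have "[int (nat (g (a \<oplus>\<^bsub>R\<^esub> b))) = int (nat (g a) + nat (g b))] (mod int m)"
      using gE(3)[OF a b] g_range a b m(1) by (simp add: S.res_add_eq cong_def)
    then show "[nat (g (a \<otimes>\<^bsub>add_monoid R\<^esub> b)) = nat (g a) + nat (g b)] (mod m)"
      by (simp only: cong_int_iff) simp
  qed (use m gE(4) cring_axioms in \<open>auto simp: a_comm_group S.res_one_eq\<close>)
  then show ?thesis by blast
qed

lemma H2_heisenberg_group_elementary:
  assumes "Factorial_Ring.prime p" "odd p" "ring R" "order R = p\<^sup>2"
    and S: "cring S" "R \<simeq> S" "add_pow S p \<one>\<^bsub>S\<^esub> = \<zero>\<^bsub>S\<^esub>"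
  shows "H2 (heisenberg_group R) complex_units \<cong> product_group {..<8::nat} (\<lambda>_. integer_mod_group p)"
proof -
  interpret S: cring S by fact
  have R: "cring R" by (rule cring_of_ring_iso[OF assms(3) S(1,2)])
  obtain h where "h \<in> ring_hom S R" using ring_hom_of_ring_iso[OF assms(3) S(2)] by blast
  then have "add_pow R p \<one>\<^bsub>R\<^esub> = \<zero>\<^bsub>R\<^esub>"
    by (rule ring_hom_add_pow_one[OF S.ring_axioms assms(3) _ S(3)])
  then obtain e \<pi> where "heisenberg_basis R p 2 e \<pi>"
    using heisenberg_basis_prime_square[OF assms(1,2) R assms(4)] by blast
  from heisenberg_basis.H2_heisenberg_group_lessThan[OF this] show ?thesis by simp
qed

theorem theorem1p1:
  fixes p :: nat
    and R :: "('a, 'm) ring_scheme"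
    and F :: "('f, 'n) ring_scheme"
  assumes "Factorial_Ring.prime p" and "odd p"
    and "ring R" and "order R = p\<^sup>2"
  shows
    "(R \<simeq> dual_numbers (residue_ring (int p)) \<longrightarrow>
        H2 (heisenberg_group R) complex_units \<cong> product_group {..<8::nat} (\<lambda>_. integer_mod_group p)) \<and>
     (field F \<and> order F = p\<^sup>2 \<and> R \<simeq> F \<longrightarrow>
        H2 (heisenberg_group R) complex_units \<cong> product_group {..<8::nat} (\<lambda>_. integer_mod_group p)) \<and>
     (R \<simeq> RDirProd (residue_ring (int p)) (residue_ring (int p)) \<longrightarrow>
        H2 (heisenberg_group R) complex_units \<cong> product_group {..<8::nat} (\<lambda>_. integer_mod_group p)) \<and>
     (R \<simeq> residue_ring (int (p\<^sup>2)) \<longrightarrow>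
        H2 (heisenberg_group R) complex_units \<cong> product_group {..<2::nat} (\<lambda>_. integer_mod_group (p\<^sup>2)))"
proof -
  let ?K = "residue_ring (int p)"
  have p1: "p > 1" using assms(1) by (rule prime_gt_1_nat)
  interpret K: residues "int p" ?K using p1 by unfold_locales auto
  note K_char = residue_ring_add_pow_order[OF p1]
  note elementary = H2_heisenberg_group_elementary[OF assms]
  note K_algebra = ring_hom_add_pow_one[OF K.ring_axioms _ _ K_char]
  show ?thesis
  proof (intro conjI impI)
    assume iso: "R \<simeq> dual_numbers ?K"
    show "H2 (heisenberg_group R) complex_units \<cong> product_group {..<8::nat} (\<lambda>_. integer_mod_group p)"
      using elementary[OF dual_numbers_properties(1)[OF assms(1)] iso]
        dual_numbers_properties(2)[OF assms(1)] K_algebra[OF cring.axioms(1)[OF dual_numbers_properties(1)[OF assms(1)]]]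
      by blast
  next
    assume F: "field F \<and> order F = p\<^sup>2 \<and> R \<simeq> F"
    then interpret F: field F by simp
    show "H2 (heisenberg_group R) complex_units \<cong> product_group {..<8::nat} (\<lambda>_. integer_mod_group p)"
      using elementary[OF F.is_cring] F F.add_pow_one_order_square by simp
  next
    assume iso: "R \<simeq> RDirProd ?K ?K"
    have "cring (RDirProd ?K ?K)" by (rule RDirProd_cring) (rule K.cring)+
    then show "H2 (heisenberg_group R) complex_units \<cong> product_group {..<8::nat} (\<lambda>_. integer_mod_group p)"
      using elementary iso K_algebra[OF cring.axioms(1) RDirProd_hom1] by blast
  next
    assume "R \<simeq> residue_ring (int (p\<^sup>2))"
    moreover have "p\<^sup>2 > 1" by (rule one_less_power[OF p1]) simp
    moreover have "odd (p\<^sup>2)" using assms(2) by simp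
    ultimately obtain e \<pi> where "heisenberg_basis R (p\<^sup>2) 1 e \<pi>"
      using heisenberg_basis_residue_ring[OF _ _ assms(3)] by blast
    from heisenberg_basis.H2_heisenberg_group_lessThan[OF this]
    show "H2 (heisenberg_group R) complex_units \<cong> product_group {..<2::nat} (\<lambda>_. integer_mod_group (p\<^sup>2))" by simp
  qed
qed

end
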